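(* Let $\mathcal F=(F_1,F_2)$ be a pair of finite sets of positive integers and $\alpha,\beta$ real numbers satisfying (A1) and (A2). Assume $$\alpha+k+1>0,\qquad\beta+k_1-k_2+1>0,\qquad\Omega^{\alpha,\beta}_{\mathcal F}(x)\neq0\ \text{for all }x\in[-1,1].$$ Then the polynomials $P^{\alpha,\beta;\mathcal F}_n$, $n\in\sigma_{\mathcal F}$, are orthogonal with respect to the positive weight $$\omega_{\alpha,\beta;\mathcal F}(x)=\frac{(1-x)^{\alpha+k}(1+x)^{\beta+k_1-k_2}}{\big(\Omega^{\alpha,\beta}_{\mathcal F}(x)\big)^2},\qquad -1<x<1,$$ and their linear combinations are dense in $L^2(\omega_{\alpha,\beta;\mathcal F})$.
   Context: $(a)_0=1$, $(a)_j=a(a+1)\cdots(a+j-1)$. Jacobi polynomials: $P^{a,b}_n(x)=2^{-n}\sum_{j=0}^n\binom{n+a}{j}\binom{n+b}{n-j}(x-1)^{n-j}(x+1)^j$. A pair $\mathcal F=(F_1,F_2)$ consists of finite sets of positive integers, not both empty, $F_i=\{f^{(i)}_1<\dots<f^{(i)}_{k_i}\}$, $k=k_1+k_2$. $u_{\mathcal F}=\sum_{f\in F_1}f+\sum_{f\in F_2}f-\binom{k_1+1}{2}-\binom{k_2}{2}$; $\sigma_{\mathcal F}=\{u_{\mathcal F},u_{\mathcal F}+1,\dots\}\setminus\{u_{\mathcal F}+f:f\in F_1\}$. (A1): $\alpha,\beta,\alpha+\beta\notin\{-1,-2,\dots\}$. (A2): if $F_2\ne\emptyset$, then $\alpha-\beta\notin\{-1,-2,\dots\}$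 and $\beta-f^{(2)}_{k_2}-1\notin\{-1,-2,\dots\}$. $P^{\alpha,\beta;\mathcal F}_n(x)=\det M_n(x)/(1+x)^{k_2(k_2-1)}$, where $M_n(x)$ is the $(k+1)\times(k+1)$ matrix with columns $j=1,\dots,k+1$, first row $((-1)^{j-1}(P^{\alpha,\beta}_{n-u_{\mathcal F}})^{(j-1)}(x))_j$, then for $f\in F_1$ increasing rows $((-1)^{j-1}(P^{\alpha,\beta}_f)^{(j-1)}(x))_j$, then for $f\in F_2$ increasing rows $((\beta-f)_{j-1}(1+x)^{k-j+1}P^{\alpha+j-1,-\beta-j+1}_f(x))_j$. $\Omega^{\alpha,\beta}_{\mathcal F}(x)=\det W(x)/(1+x)^{k_2(k_2-1)}$, with $W(x)$ the $k\times k$ matrix (columns $j=1..k$) with rows $((-1)^{j-1}(P^{\alpha,\beta}_f)^{(j-1)}(x))_j$ for $f\in F_1$ increasing, then $((\beta-f)_{j-1}(1+x)^{k-j}P^{\alpha+j-1,-\beta-j+1}_f(x))_j$ for $f\in F_2$ increasing. *)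

theory Defs
  imports "HOL-Analysis.Analysis" "HOL-Computational_Algebra.Polynomial"
    "Jordan_Normal_Form.Determinant"
begin

definition neg_int :: "real \<Rightarrow> bool" where
  "neg_int x \<longleftrightarrow> (\<exists>m::nat. 0 < m \<and> x = - real m)"

definition jacobi :: "real \<Rightarrow> real \<Rightarrow> nat \<Rightarrow> real poly" where
  "jacobi a b n = Polynomial.smult (1 / 2 ^ n)
     (\<Sum>j=0..n. Polynomial.smult (((real n + a) gchoose j) * ((real n + b) gchoose (n - j)))
                   ([:-1, 1:] ^ (n - j) * [:1, 1:] ^ j))"

definition pder :: "nat \<Rightarrow> real poly \<Rightarrow> real poly" where
  "pder j p = (pderiv ^^ j) p"

definition kF :: "nat set \<Rightarrow> nat set \<Rightarrow> nat" where
  "kF F1 F2 = card F1 + card F2"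

definition uF :: "nat set \<Rightarrow> nat set \<Rightarrow> nat" where
  "uF F1 F2 = \<Sum>F1 + \<Sum>F2 - ((card F1 + 1) choose 2) - (card F2 choose 2)"

definition sigmaF :: "nat set \<Rightarrow> nat set \<Rightarrow> nat set" where
  "sigmaF F1 F2 = {n. uF F1 F2 \<le> n} - {uF F1 F2 + f | f. f \<in> F1}"

text \<open>Row (0-indexed columns c = j-1) of an F2-element f in a matrix with k+1-c exponent offset e:
  ((beta-f)_c (1+x)^(e-c) P^{alpha+c, -beta-c}_f(x))\<close>
definition F2_entry :: "real \<Rightarrow> real \<Rightarrow> nat \<Rightarrow> nat \<Rightarrow> nat \<Rightarrow> real poly" where
  "F2_entry \<alpha> \<beta> e f c =
     Polynomial.smult (pochhammer (\<beta> - real f) c) ([:1, 1:] ^ (e - c) * jacobi (\<alpha> + real c) (- \<beta> - real c) f)"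

definition F1_entry :: "real \<Rightarrow> real \<Rightarrow> nat \<Rightarrow> nat \<Rightarrow> real poly" where
  "F1_entry \<alpha> \<beta> f c = Polynomial.smult ((-1) ^ c) (pder c (jacobi \<alpha> \<beta> f))"

definition Mmat :: "real \<Rightarrow> real \<Rightarrow> nat set \<Rightarrow> nat set \<Rightarrow> nat \<Rightarrow> real poly mat" where
  "Mmat \<alpha> \<beta> F1 F2 n =
     (let k1 = card F1; k = kF F1 F2;
          L1 = sorted_list_of_set F1; L2 = sorted_list_of_set F2 in
      mat (k + 1) (k + 1) (\<lambda>(i, c).
        if i = 0 then F1_entry \<alpha> \<beta> (n - uF F1 F2) c
        else if i \<le> k1 then F1_entry \<alpha> \<beta> (L1 ! (i - 1)) c
        else F2_entry \<alpha> \<beta> k (L2 ! (i - 1 - k1)) c))"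

definition Wmat :: "real \<Rightarrow> real \<Rightarrow> nat set \<Rightarrow> nat set \<Rightarrow> real poly mat" where
  "Wmat \<alpha> \<beta> F1 F2 =
     (let k1 = card F1; k = kF F1 F2;
          L1 = sorted_list_of_set F1; L2 = sorted_list_of_set F2 in
      mat k k (\<lambda>(i, c).
        if i < k1 then F1_entry \<alpha> \<beta> (L1 ! i) c
        else F2_entry \<alpha> \<beta> (k - 1) (L2 ! (i - k1)) c))"

text \<open>P^{alpha,beta;F}_n = det M_n / (1+x)^{k2(k2-1)} (exact polynomial division)\<close>
definition jacobiF :: "real \<Rightarrow> real \<Rightarrow> nat set \<Rightarrow> nat set \<Rightarrow> nat \<Rightarrow> real poly" where
  "jacobiF \<alpha> \<beta> F1 F2 n =
     Determinant.det (Mmat \<alpha> \<beta> F1 F2 n) div [:1, 1:] ^ (card F2 * (card F2 - 1))"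

definition OmegaF :: "real \<Rightarrow> real \<Rightarrow> nat set \<Rightarrow> nat set \<Rightarrow> real poly" where
  "OmegaF \<alpha> \<beta> F1 F2 =
     Determinant.det (Wmat \<alpha> \<beta> F1 F2) div [:1, 1:] ^ (card F2 * (card F2 - 1))"

definition weightF :: "real \<Rightarrow> real \<Rightarrow> nat set \<Rightarrow> nat set \<Rightarrow> real \<Rightarrow> real" where
  "weightF \<alpha> \<beta> F1 F2 x =
     (1 - x) powr (\<alpha> + real (kF F1 F2)) * (1 + x) powr (\<beta> + real (card F1) - real (card F2))
       / (poly (OmegaF \<alpha> \<beta> F1 F2) x)\<^sup>2"

end

(*
  Put t = 1 + x.  The F2-rows of the two matrices are, up to a common factor, the successive
  derivatives of t^(-beta) P_f^(alpha,-beta); these functions and the P_f with f in F1 are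
  eigenfunctions ("seeds") of the Jacobi operator (1-x^2) y'' + q y'.  So P_n^F is, up to the factor
  t^k2 Omega, the value at P_(n-u) of the monic operator psi of order k whose kernel is spanned by
  the seeds.

  Orthogonality: psi intertwines the Jacobi operator with (1-x^2) y'' + (q - 2kx) y' + r y for some
  function r, because the difference is an operator of order at most k that kills the seeds and is
  therefore a multiple of psi.  The new operator is symmetric for (1-x)^(alpha+k) (1+x)^(beta+k), and
  the boundary terms vanish by the two inequalities on the exponents.  The norms do not vanish
  because the eigenvalues of P_m, m not in F1, differ from those of the seeds.

  Density: as Omega has no zero, variation of parameters solves psi y = h for h continuous with
  compact support in (-1,1), by a y that vanishes near -1.  Near 1 it is a combination of seeds, which
  are smooth there, so y is k times continuously differentiable on [-1,1].  Approximating y by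
  polynomials together with its first k derivatives approximates h uniformly by linear combinations of
  the P_n^F.
*)
theory Submission
  imports Defs
begin

section \<open>Jacobi polynomials\<close>

text \<open>The definitions divide by \<open>(1+x)^(k2(k2-1))\<close>, and the operator behind them
  needs polynomial coefficients, so exactness of the division has to be proved for every cofactor of
  the first row, not just for the determinants. It is a count of orders at -1: rows are linear in
  their polynomial, and for a power of 1+x every entry is a constant times a power of 1+x.

  Wronskian arguments are replaced by the inverse \<open>V\<close> of the matrix of seed
  derivatives, available on (-1,1) because its determinant is Omega up to nonvanishing factors.
  \<open>V\<close> supplies uniqueness of operators, independence of the seeds and the kernels in
  variation of parameters.

  The two endpoints are not alike. Seeds from F2 carry \<open>(1+x) powr (-\<beta>)\<close> and may
  blow up at -1, whereas at 1 all seeds are smooth; therefore integration starts at -1, where the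
  test function vanishes. The gaps in sigma are harmless for density: an arbitrary polynomial is
  expanded in all P_m, and the P_f with f in F1 are killed.\<close>

lemma smult_sum_right: "Polynomial.smult a (sum f S) = (\<Sum>i\<in>S. Polynomial.smult a (f i))"
  by (induction S rule: infinite_finite_induct) (auto simp: smult_add_right)

lemma pderiv_sum: "pderiv (sum f S) = (\<Sum>i\<in>S. pderiv (f i))"
  by (induction S rule: infinite_finite_induct) (auto simp: pderiv_add)

text \<open>The factors x - 1 and x + 1 become independent arguments, so that exchanging them
  together with a and b is a symmetry and both raising formulas follow from one.\<close>

definition jac2 :: "real \<Rightarrow> real \<Rightarrow> nat \<Rightarrow> real poly \<Rightarrow> real poly \<Rightarrow> real poly" where
  "jac2 a b n s t = (\<Sum>j=0..n. Polynomial.smult (((real n + a) gchoose j) * ((real n + b) gchoose (n - j))) (s ^ (n - j) * t ^ j))"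

lemma jacobi_jac2: "jacobi a b n = Polynomial.smult (1 / 2 ^ n) (jac2 a b n [:-1,1:] [:1,1:])"
  by (simp add: jacobi_def jac2_def)

lemma jac2_swap: "jac2 a b n s t = jac2 b a n t s"
proof -
  have "jac2 a b n s t = (\<Sum>j=0..n. Polynomial.smult (((real n + a) gchoose (n - j)) * ((real n + b) gchoose (n - (n - j)))) (s ^ (n - (n - j)) * t ^ (n - j)))"
    unfolding jac2_def by (rule sum.reindex_bij_witness[where i="\<lambda>j. n - j" and j="\<lambda>j. n - j"]) auto
  also have "\<dots> = jac2 b a n t s"
    unfolding jac2_def by (rule sum.cong) (auto simp: mult.commute)
  finally show ?thesis .
qed

text \<open>The operator on the left maps \<open>s^(n-j) t^j\<close> to a combination of itself and
  the term with j + 1. Collecting equal terms leaves an identity of binomial products: absorption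
  extracts n + b from both summands and Pascal's rule adds the remaining factors.\<close>

lemma jac2_raise:
  assumes ds: "pderiv s = 1" and dt: "pderiv t = 1"
  shows "t * pderiv (jac2 a b n s t) + Polynomial.smult b (jac2 a b n s t)
    = Polynomial.smult (real n + b) (jac2 (a + 1) (b - 1) n s t)"
proof -
  define A where "A j = ((real n + a) gchoose j) * ((real n + b) gchoose (n - j))" for j
  have 1: "t * pderiv (s ^ i * t ^ j) + Polynomial.smult b (s ^ i * t ^ j)
     = Polynomial.smult (real j + b) (s ^ i * t ^ j) + Polynomial.smult (real i) (s ^ (i - 1) * t ^ (j + 1))" for i j
  proof -
    have t: "t * pderiv (t ^ j) = Polynomial.smult (real j) (t ^ j)"
      using dt by (cases j) (simp_all only: pderiv_power_Suc, auto)
    have s: "pderiv (s ^ i) = Polynomial.smult (real i) (s ^ (i - 1))"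
      using ds by (cases i) (simp_all only: pderiv_power_Suc, auto)
    have "t * pderiv (s ^ i * t ^ j) = s ^ i * (t * pderiv (t ^ j)) + t * t ^ j * pderiv (s ^ i)"
      by (simp add: pderiv_mult algebra_simps)
    then show ?thesis unfolding t s by (simp add: smult_add_left mult_ac)
  qed
  have "t * pderiv (jac2 a b n s t) + Polynomial.smult b (jac2 a b n s t)
     = (\<Sum>j=0..n. Polynomial.smult (A j) (t * pderiv (s ^ (n - j) * t ^ j) + Polynomial.smult b (s ^ (n - j) * t ^ j)))"
    unfolding jac2_def A_def[symmetric] 
    by (simp add: pderiv_sum pderiv_smult sum_distrib_left smult_sum_right smult_add_right sum.distrib mult.commute)
  also have "\<dots> = (\<Sum>j=0..n. Polynomial.smult (A j * (real j + b)) (s ^ (n - j) * t ^ j))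
     + (\<Sum>j=0..n. Polynomial.smult (A j * real (n - j)) (s ^ (n - j - 1) * t ^ (j + 1)))"
    by (simp only: 1 smult_add_right sum.distrib smult_smult)
  also have "(\<Sum>j=0..n. Polynomial.smult (A j * real (n - j)) (s ^ (n - j - 1) * t ^ (j + 1)))
     = (\<Sum>j=0..<n. Polynomial.smult (A j * real (n - j)) (s ^ (n - j - 1) * t ^ (j + 1)))"
    by (rule sum.mono_neutral_right) auto
  also have "\<dots> = (\<Sum>j=1..n. Polynomial.smult (A (j - 1) * real (n - (j - 1))) (s ^ (n - j) * t ^ j))"
    by (rule sum.reindex_bij_witness[where i="\<lambda>j. j - 1" and j="\<lambda>j. j + 1"]) auto
  also have "\<dots> = (\<Sum>j=0..n. Polynomial.smult (if j = 0 then 0 else A (j - 1) * real (n - (j - 1))) (s ^ (n - j) * t ^ j))"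
    by (rule sum.mono_neutral_cong_left) auto
  finally have 2: "t * pderiv (jac2 a b n s t) + Polynomial.smult b (jac2 a b n s t) = 
     (\<Sum>j=0..n. Polynomial.smult (A j * (real j + b) + (if j = 0 then 0 else A (j - 1) * real (n - (j - 1)))) (s ^ (n - j) * t ^ j))"
    by (simp only: sum.distrib smult_add_left)
  have 3: "A j * (real j + b) + (if j = 0 then 0 else A (j - 1) * real (n - (j - 1)))
     = (real n + b) * (((real n + (a + 1)) gchoose j) * ((real n + (b - 1)) gchoose (n - j)))" if "j \<le> n" for j
  proof -
    have e1: "(real j + b) * ((real n + b) gchoose (n - j)) = (real n + b) * ((real n + b - 1) gchoose (n - j))"
      using gbinomial_absorb_comp[of "real n + b" "n - j"] that by (simp add: of_nat_diff algebra_simps)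
    show ?thesis
    proof (cases j)
      case 0
      then show ?thesis using e1 by (simp add: A_def algebra_simps)
    next
      case (Suc i)
      have "n - i = Suc (n - j)" using Suc that by auto
      then have e2: "((real n + b) gchoose (n - i)) * real (n - i) = (real n + b) * ((real n + b - 1) gchoose (n - j))"
        using gbinomial_absorption[of "n - j" "real n + b"] by (simp add: algebra_simps)
      have e3: "(real n + (a + 1)) gchoose j = ((real n + a) gchoose i) + ((real n + a) gchoose j)"
        using gbinomial_Suc_Suc[of "real n + a" i] Suc by (simp add: algebra_simps)
      have "A j * (real j + b) = ((real n + a) gchoose j) * ((real n + b) * ((real n + b - 1) gchoose (n - j)))"
        unfolding A_def e1[symmetric] by (simp add: algebra_simps)
      moreover have "A i * real (n - i) = ((real n + a) gchoose i) * ((real n + b) * ((real n + b - 1) gchoose (n - j)))"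
        unfolding A_def e2[symmetric] by (simp add: algebra_simps)
      ultimately show ?thesis using Suc unfolding e3 by (simp add: algebra_simps)
    qed
  qed
  have "Polynomial.smult (real n + b) (jac2 (a + 1) (b - 1) n s t) = 
     (\<Sum>j=0..n. Polynomial.smult ((real n + b) * (((real n + (a + 1)) gchoose j) * ((real n + (b - 1)) gchoose (n - j)))) (s ^ (n - j) * t ^ j))"
    unfolding jac2_def by (simp add: smult_sum_right)
  then show ?thesis unfolding 2 by (simp only:) (rule sum.cong, use 3 in auto)
qed

lemma jacobi_raise_right:
  "[:1,1:] * pderiv (jacobi a b n) + Polynomial.smult b (jacobi a b n) = Polynomial.smult (real n + b) (jacobi (a + 1) (b - 1) n)"
proof -
  have "Polynomial.smult (1/2^n) ([:1,1:] * pderiv (jac2 a b n [:-1,1:] [:1,1:]) + Polynomial.smult b (jac2 a b n [:-1,1:] [:1,1:]))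
    = Polynomial.smult (1/2^n) (Polynomial.smult (real n + b) (jac2 (a + 1) (b - 1) n [:-1,1:] [:1,1:]))"
    by (subst jac2_raise) (auto simp: pderiv_pCons)
  then show ?thesis unfolding jacobi_jac2 
    by (simp only: pderiv_smult smult_add_right mult_smult_right smult_smult mult.commute)
qed

lemma jacobi_raise_left:
  "[:-1,1:] * pderiv (jacobi a b n) + Polynomial.smult a (jacobi a b n) = Polynomial.smult (real n + a) (jacobi (a - 1) (b + 1) n)"
proof -
  have "Polynomial.smult (1/2^n) ([:-1,1:] * pderiv (jac2 b a n [:1,1:] [:-1,1:]) + Polynomial.smult a (jac2 b a n [:1,1:] [:-1,1:]))
    = Polynomial.smult (1/2^n) (Polynomial.smult (real n + a) (jac2 (b + 1) (a - 1) n [:1,1:] [:-1,1:]))"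
    by (subst jac2_raise) (auto simp: pderiv_pCons)
  then show ?thesis unfolding jacobi_jac2 jac2_swap[of _ _ _ "[:-1,1:]"]
    by (simp only: pderiv_smult smult_add_right mult_smult_right smult_smult mult.commute)
qed

text \<open>The two raising formulas lead from (a, b) to (a+1, b-1) and back. Eliminating the
  intermediate polynomial \<open>z\<close> from them and from the derivative of the first gives the
  second-order equation.\<close>

lemma jacobi_ode:
  "(1 - x^2) * poly (pderiv (pderiv (jacobi a b n))) x + (b - a - (a + b + 2) * x) * poly (pderiv (jacobi a b n)) x
    = - real n * (real n + a + b + 1) * poly (jacobi a b n) x"
proof -
  define y where "y = jacobi a b n"
  define z where "z = jacobi (a + 1) (b - 1) n"
  have 1: "[:1,1:] * pderiv y + Polynomial.smult b y = Polynomial.smult (real n + b) z"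
    unfolding y_def z_def by (rule jacobi_raise_right)
  have 2: "[:-1,1:] * pderiv z + Polynomial.smult (a + 1) z = Polynomial.smult (real n + (a + 1)) y"
    using jacobi_raise_left[of "a+1" "b-1" n] unfolding y_def z_def by simp
  have 3: "[:1,1:] * pderiv (pderiv y) + pderiv y + Polynomial.smult b (pderiv y) = Polynomial.smult (real n + b) (pderiv z)"
    using arg_cong[OF 1, of pderiv] by (simp add: pderiv_mult pderiv_add pderiv_smult pderiv_pCons algebra_simps)
  have p1: "(1 + x) * poly (pderiv y) x + b * poly y x = (real n + b) * poly z x" 
    using arg_cong[OF 1, of "\<lambda>p. poly p x"] by (simp add: algebra_simps)
  have p2: "(x - 1) * poly (pderiv z) x + (a + 1) * poly z x = (real n + a + 1) * poly y x" 
    using arg_cong[OF 2, of "\<lambda>p. poly p x"] by (simp add: algebra_simps)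
  have p3: "(1 + x) * poly (pderiv (pderiv y)) x + (1 + b) * poly (pderiv y) x = (real n + b) * poly (pderiv z) x" 
    using arg_cong[OF 3, of "\<lambda>p. poly p x"] by (simp add: algebra_simps)
  have "(real n + b) * ((x - 1) * poly (pderiv z) x + (a + 1) * poly z x) = (real n + b) * (real n + a + 1) * poly y x"
    unfolding p2 by simp
  then have "(x - 1) * ((real n + b) * poly (pderiv z) x) + (a + 1) * ((real n + b) * poly z x) = (real n + b) * (real n + a + 1) * poly y x"
    by (simp add: algebra_simps)
  then have "(x - 1) * ((1 + x) * poly (pderiv (pderiv y)) x + (1 + b) * poly (pderiv y) x) + (a + 1) * ((1 + x) * poly (pderiv y) x + b * poly y x) = (real n + b) * (real n + a + 1) * poly y x"
    by (simp only: p1 p3)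
  then show ?thesis unfolding y_def[symmetric]
    by (simp add: algebra_simps power2_eq_square)
qed

lemma degree_jacobi_le: "degree (jacobi a b n) \<le> n"
proof -
  have d: "degree ([:-1, 1::real:] ^ (n - j) * [:1, 1:] ^ j) = n" if "j \<le> n" for j
    using that by (simp add: degree_mult_eq degree_power_eq)
  show ?thesis
    unfolding jacobi_def by (intro degree_smult_le[THEN order_trans] degree_sum_le) (use d in auto)
qed

text \<open>All products \<open>(x-1)^(n-j) (x+1)^j\<close> are monic, so the coefficient is a
  Vandermonde sum: up to a power of 2, the binomial 2n+a+b over n. It vanishes only if a + b = -(2n
  - i) with i < n.\<close>

lemma coeff_jacobi_top:
  assumes "\<not> neg_int (a + b)"
  shows "coeff (jacobi a b n) n \<noteq> 0"
proof -
  have d: "degree ([:-1, 1::real:] ^ (n - j) * [:1, 1:] ^ j) = n" if "j \<le> n" for j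
    using that by (simp add: degree_mult_eq degree_power_eq)
  have lc: "coeff ([:-1, 1::real:] ^ (n - j) * [:1, 1:] ^ j) n = 1" if "j \<le> n" for j
  proof -
    have "lead_coeff ([:-1, 1::real:] ^ (n - j) * [:1, 1:] ^ j) = 1"
      by (simp add: lead_coeff_mult lead_coeff_power)
    then show ?thesis using d[OF that] by simp
  qed
  have "coeff (jacobi a b n) n = 1/2^n * (\<Sum>j=0..n. ((real n + a) gchoose j) * ((real n + b) gchoose (n - j)))"
    unfolding jacobi_def by (simp add: coeff_sum lc)
  also have "\<dots> = 1/2^n * ((real n + a + (real n + b)) gchoose n)"
    by (simp only: gbinomial_Vandermonde)
  also have "\<dots> \<noteq> 0"
  proof -
    have "(\<Prod>i = 0..<n. (real n + a + (real n + b)) - of_nat i) \<noteq> 0"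
    proof -
      have "(real n + a + (real n + b)) - of_nat i \<noteq> 0" if i: "i \<in> {0..<n}" for i
      proof
        assume "(real n + a + (real n + b)) - of_nat i = 0"
        then have "a + b = - real (2 * n - i)" "0 < 2 * n - i" using i by (auto simp: of_nat_diff)
        then show False using assms unfolding neg_int_def by blast
      qed
      then show ?thesis by (subst prod_zero_iff) auto
    qed
    then show ?thesis using gbinomial_mult_fact[of n "real n + a + (real n + b)"] by auto
  qed
  finally show ?thesis .
qed

lemma degree_jacobi: "\<not> neg_int (a + b) \<Longrightarrow> degree (jacobi a b n) = n"
  by (intro antisym degree_jacobi_le le_degree coeff_jacobi_top)

lemma jacobi_nonzero: "\<not> neg_int (a + b) \<Longrightarrow> jacobi a b n \<noteq> 0"
  using coeff_jacobi_top[of a b n] by auto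

section \<open>Divisibility of the determinants\<close>

definition deriv_row :: "nat \<Rightarrow> real poly \<Rightarrow> real poly" where
  "deriv_row c p = Polynomial.smult ((-1) ^ c) (pder c p)"

text \<open>The c-th derivative of (1+x) powr (-\<beta>) times q is (-1) ^ c * (1+x) powr (-\<beta>-c) times shifted_row \<beta> c q.\<close>

fun shifted_row :: "real \<Rightarrow> nat \<Rightarrow> real poly \<Rightarrow> real poly" where
  "shifted_row \<beta> 0 q = q"
| "shifted_row \<beta> (Suc c) q = Polynomial.smult (\<beta> + real c) (shifted_row \<beta> c q) - [:1,1:] * pderiv (shifted_row \<beta> c q)"

text \<open>\<open>T\<close> marks F1-type rows and \<open>e\<close> is the offset of the power of
  1+x, which is k in M and k - 1 in W. The polynomial is left arbitrary because the entry is linear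
  in it, so divisibility can be tested on powers of 1+x.\<close>

definition seed_entry :: "real \<Rightarrow> nat \<Rightarrow> bool \<Rightarrow> nat \<Rightarrow> real poly \<Rightarrow> real poly" where
  "seed_entry \<beta> e T c p = (if T then deriv_row c p else [:1,1:] ^ (e - c) * shifted_row \<beta> c p)"

lemma pder_Suc: "pder (Suc c) p = pderiv (pder c p)"
  by (simp add: pder_def)

lemma pder_0 [simp]: "pder 0 p = p"
  by (simp add: pder_def)

lemma pder_add: "pder c (p + q) = pder c p + pder c q"
  by (induction c) (auto simp: pder_Suc pderiv_add)

lemma pder_smult: "pder c (Polynomial.smult a p) = Polynomial.smult a (pder c p)"
  by (induction c) (auto simp: pder_Suc pderiv_smult)

lemma deriv_row_add: "deriv_row c (p + q) = deriv_row c p + deriv_row c q"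
  by (simp add: deriv_row_def pder_add smult_add_right)

lemma deriv_row_smult: "deriv_row c (Polynomial.smult a p) = Polynomial.smult a (deriv_row c p)"
  by (simp add: deriv_row_def pder_smult mult.commute)

lemma deriv_row_Suc: "deriv_row (Suc c) p = - pderiv (deriv_row c p)"
  by (simp add: deriv_row_def pder_Suc pderiv_smult)

lemma shifted_row_add: "shifted_row \<beta> c (p + q) = shifted_row \<beta> c p + shifted_row \<beta> c q"
  by (induction c) (auto simp: pderiv_add smult_add_right algebra_simps)

lemma shifted_row_smult: "shifted_row \<beta> c (Polynomial.smult a p) = Polynomial.smult a (shifted_row \<beta> c p)"
  by (induction c) (auto simp: pderiv_smult smult_diff_right mult.commute)

lemma seed_entry_add: "seed_entry \<beta> e T c (p + q) = seed_entry \<beta> e T c p + seed_entry \<beta> e T c q"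
  by (simp add: seed_entry_def deriv_row_add shifted_row_add algebra_simps)

lemma seed_entry_smult: "seed_entry \<beta> e T c (Polynomial.smult a p) = Polynomial.smult a (seed_entry \<beta> e T c p)"
  by (simp add: seed_entry_def deriv_row_smult shifted_row_smult)

lemma t_pderiv_power: "[:1,1:] * pderiv ([:1,1::real:] ^ j) = Polynomial.smult (real j) ([:1,1:] ^ j)"
  by (cases j) (simp_all only: pderiv_power_Suc, auto simp: pderiv_pCons)

text \<open>Multiplying by \<open>(1+x)^c\<close> compensates the drop of the exponent, so the
  formula stays polynomial also for c > j, where the Pochhammer symbol vanishes.\<close>

lemma deriv_row_power: "[:1,1:] ^ c * deriv_row c ([:1,1:] ^ j) = Polynomial.smult (pochhammer (- real j) c) ([:1,1:] ^ j)"
proof (induction c)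
  case 0
  then show ?case by (simp add: deriv_row_def)
next
  case (Suc c)
  define X where "X = deriv_row c ([:1,1:] ^ j)"
  have "[:1,1:] * pderiv ([:1,1:] ^ c * X) = [:1,1:] * pderiv (Polynomial.smult (pochhammer (- real j) c) ([:1,1:] ^ j))"
    using Suc X_def by simp
  then have "([:1,1:] * pderiv ([:1,1:] ^ c)) * X + [:1,1:] ^ Suc c * pderiv X = Polynomial.smult (pochhammer (- real j) c) ([:1,1:] * pderiv ([:1,1:] ^ j))"
    by (simp add: pderiv_mult pderiv_smult algebra_simps)
  then have "[:1,1:] ^ Suc c * pderiv X = Polynomial.smult (pochhammer (- real j) c * real j) ([:1,1:] ^ j) - Polynomial.smult (real c) ([:1,1:] ^ c * X)"
    unfolding t_pderiv_power by (simp add: algebra_simps)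
  also have "\<dots> = Polynomial.smult (pochhammer (- real j) c * (real j - real c)) ([:1,1:] ^ j)"
    using Suc X_def by (simp add: algebra_simps smult_diff_left)
  finally have "[:1,1:] ^ Suc c * (- pderiv X) = - Polynomial.smult (pochhammer (- real j) c * (real j - real c)) ([:1,1:] ^ j)"
    by simp
  also have "\<dots> = Polynomial.smult (pochhammer (- real j) (Suc c)) ([:1,1:] ^ j)"
    by (simp add: pochhammer_Suc algebra_simps flip: smult_minus_left)
  finally show ?case unfolding deriv_row_Suc X_def .
qed

lemma shifted_row_power: "shifted_row \<beta> c ([:1,1:] ^ j) = Polynomial.smult (pochhammer (\<beta> - real j) c) ([:1,1:] ^ j)"
proof (induction c)
  case (Suc c)
  then show ?case
    by (simp only: shifted_row.simps pderiv_smult mult_smult_right t_pderiv_power) (simp add: pochhammer_Suc algebra_simps flip: smult_diff_left)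
qed simp

lemma det_scale_rows:
  fixes a :: "nat \<Rightarrow> nat \<Rightarrow> 'a::comm_ring_1"
  shows "Determinant.det (mat n n (\<lambda>(i,c). f i * a i c)) = prod f {0..<n} * Determinant.det (mat n n (\<lambda>(i,c). a i c))"
proof -
  have "(\<Prod>i = 0..<n. mat n n (\<lambda>(i,c). f i * a i c) $$ (i, p i)) = prod f {0..<n} * (\<Prod>i = 0..<n. mat n n (\<lambda>(i,c). a i c) $$ (i, p i))"
    if "p permutes {0..<n}" for p
    using that permutes_in_image[OF that] by (simp add: prod.distrib)
  then show ?thesis
    unfolding Determinant.det_def'[OF mat_carrier] sum_distrib_left
    by (intro sum.cong) (auto simp only: mem_Collect_eq mult_ac)
qed

lemma det_scale_cols:
  fixes a :: "nat \<Rightarrow> nat \<Rightarrow> 'a::comm_ring_1"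
  shows "Determinant.det (mat n n (\<lambda>(i,c). f c * a i c)) = prod f {0..<n} * Determinant.det (mat n n (\<lambda>(i,c). a i c))"
proof -
  have "(\<Prod>i = 0..<n. mat n n (\<lambda>(i,c). f c * a i c) $$ (i, p i)) = prod f {0..<n} * (\<Prod>i = 0..<n. mat n n (\<lambda>(i,c). a i c) $$ (i, p i))"
    if "p permutes {0..<n}" for p
    using that permutes_in_image[OF that] by (simp add: prod.distrib prod.permute[OF that, of f] o_def)
  then show ?thesis
    unfolding Determinant.det_def'[OF mat_carrier] sum_distrib_left
    by (intro sum.cong) (auto simp only: mem_Collect_eq mult_ac)
qed

lemma sum_lessThan_add: "\<Sum>{0..<m + k} = \<Sum>{0..<m} + \<Sum>{0..<k} + m * (k::nat)"
  by (induction k) auto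

text \<open>Multiplying column c by (1+x) ^ c makes every row a power of 1+x times a constant row, so the order of vanishing at -1 can be read off from the exponents. Rows of the same type with equal exponents coincide.\<close>

lemma dvd_det_power_rows:
  fixes n :: nat and g :: "nat \<Rightarrow> nat" and T :: "nat \<Rightarrow> bool"
  defines "k2 \<equiv> card {i. i < n \<and> \<not> T i}"
  shows "[:1,1:] ^ (k2 * (k2 - 1)) dvd Determinant.det (mat n n (\<lambda>(i,c). seed_entry \<beta> (n - 1) (T i) c ([:1,1:] ^ g i)))"
    (is "_ dvd Determinant.det ?A")
proof (cases "\<exists>i<n. \<exists>j<n. i \<noteq> j \<and> T i = T j \<and> g i = g j")
  case True
  then obtain i j where ij: "i < n" "j < n" "i \<noteq> j" "T i = T j" "g i = g j" by blast
  have "Determinant.det ?A = 0"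
    by (rule Determinant.det_identical_rows[OF _ ij(3,1,2)]) (use ij in \<open>auto intro!: eq_vecI\<close>)
  then show ?thesis by simp
next
  case False
  define t :: "real poly" where "t = [:1,1:]"
  define \<kappa> where "\<kappa> i c = pochhammer ((if T i then 0 else \<beta>) - real (g i)) c" for i c
  \<comment> \<open>The exponent left after the column scaling: entry c of a shifted row has offset
    n - 1 - c, which the factor \<open>t^c\<close> completes to n - 1.\<close>
  define E where "E i = (if T i then g i else (n - 1) + g i)" for i
  have t0: "t \<noteq> 0" by (simp add: t_def)
  have e: "t ^ c * seed_entry \<beta> (n - 1) (T i) c ([:1,1:] ^ g i) = t ^ E i * [:\<kappa> i c:]" if "c < n" for i c
  proof (cases "T i")
    case True
    then show ?thesis using deriv_row_power[of c "g i"] by (simp add: t_def seed_entry_def \<kappa>_def E_def)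
  next
    case False
    have "t ^ c * t ^ (n - 1 - c) = t ^ (n - 1)" using that by (simp flip: power_add)
    then show ?thesis using shifted_row_power[of \<beta> c "g i"] False
      by (simp add: t_def[symmetric] seed_entry_def \<kappa>_def E_def power_add mult.assoc[symmetric])
  qed
  have "mat n n (\<lambda>(i,c). t ^ c * seed_entry \<beta> (n - 1) (T i) c ([:1,1:] ^ g i)) = mat n n (\<lambda>(i,c). t ^ E i * [:\<kappa> i c:])"
    by (rule eq_matI) (auto simp only: dim_row_mat dim_col_mat index_mat prod.case e)
  then have "prod (\<lambda>c. t ^ c) {0..<n} * Determinant.det ?A = prod (\<lambda>i. t ^ E i) {0..<n} * Determinant.det (mat n n (\<lambda>(i,c). [:\<kappa> i c:]))"
    using det_scale_cols[of n "\<lambda>c. t ^ c" "\<lambda>i c. seed_entry \<beta> (n - 1) (T i) c ([:1,1:] ^ g i)"] 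
       det_scale_rows[of n "\<lambda>i. t ^ E i" "\<lambda>i c. [:\<kappa> i c:]"] by simp
  then have eq: "t ^ (\<Sum>{0..<n}) * Determinant.det ?A = t ^ (\<Sum>i\<in>{0..<n}. E i) * Determinant.det (mat n n (\<lambda>(i,c). [:\<kappa> i c:]))"
    by (simp add: power_sum)
  define S1 where "S1 = {i. i < n \<and> T i}"
  define S2 where "S2 = {i. i < n \<and> \<not> T i}"
  have S: "{0..<n} = S1 \<union> S2" "S1 \<inter> S2 = {}" "finite S1" "finite S2" by (auto simp: S1_def S2_def)
  have cn: "n = card S1 + k2" using card_Un_disjoint[OF S(3,4,2)] S(1) 
    by (metis S2_def card_atLeastLessThan diff_zero k2_def)
  \<comment> \<open>Exponents are pairwise distinct within each row type, so their sum is at least 0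
    + 1 + 2 + ... .\<close>
  have s1: "\<Sum>{0..<card S1} \<le> sum g S1"
  proof -
    have inj: "inj_on g S1" using False by (auto simp: inj_on_def S1_def)
    show ?thesis using card_sum_le_nat_sum[of "g ` S1"] inj
      by (simp add: card_image sum.reindex)
  qed
  have s2: "\<Sum>{0..<k2} \<le> sum g S2"
  proof -
    have inj: "inj_on g S2" using False by (auto simp: inj_on_def S2_def)
    show ?thesis using card_sum_le_nat_sum[of "g ` S2"] inj
      by (simp add: card_image sum.reindex k2_def S2_def)
  qed
  have "sum E {0..<n} = sum E S1 + sum E S2" using S by (simp add: sum.union_disjoint)
  also have "sum E S1 = sum g S1" by (rule sum.cong) (auto simp: E_def S1_def)
  also have "sum E S2 = (\<Sum>i\<in>S2. (n - 1) + g i)" by (rule sum.cong) (auto simp: E_def S2_def)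
  also have "\<dots> = k2 * (n - 1) + sum g S2" by (simp only: sum.distrib sum_constant k2_def S2_def of_nat_id)
  finally have sE: "sum E {0..<n} = sum g S1 + (k2 * (n - 1) + sum g S2)" .
  \<comment> \<open>The columns consumed \<open>t^(0+...+(n-1))\<close>. Splitting that sum by row
    type, the surplus is k2(n-1) minus the mixed term card S1 times k2, which is k2(k2-1).\<close>
  have "k2 * (k2 - 1) + card S1 * k2 = k2 * (n - 1)"
    using cn by (cases k2) (auto simp: algebra_simps)
  then have "k2 * (k2 - 1) + \<Sum>{0..<n} \<le> sum E {0..<n}"
    using s1 s2 sE sum_lessThan_add[of "card S1" k2] cn by simp
  then have "t ^ (k2 * (k2 - 1) + \<Sum>{0..<n}) dvd t ^ (sum E {0..<n})" by (rule le_imp_power_dvd)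
  then have "t ^ (k2 * (k2 - 1)) * t ^ (\<Sum>{0..<n}) dvd Determinant.det ?A * t ^ (\<Sum>{0..<n})"
    using eq by (simp add: power_add mult.commute)
  then show ?thesis using t0 by (simp add: t_def)
qed

lemma cofactor_row_cong:
  assumes "A \<in> carrier_mat n n" "B \<in> carrier_mat n n"
    and "\<And>i j. i < n \<Longrightarrow> j < n \<Longrightarrow> i \<noteq> s \<Longrightarrow> A $$ (i,j) = B $$ (i,j)"
  shows "Determinant.cofactor A s c = Determinant.cofactor B s c"
proof -
  have "mat_delete A s c = mat_delete B s c"
    using assms by (intro eq_matI) (auto simp: mat_delete_def)
  then show ?thesis by (simp add: Determinant.cofactor_def)
qed

text \<open>Powers of 1+x span the polynomials. The induction runs over ordinary coefficients, so it
  is carried out for \<open>(1+x)^j * r\<close>, and x is written as (1+x) - 1, which raises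
  j.\<close>

lemma shifted_power_induct:
  fixes P :: "real poly \<Rightarrow> bool"
  assumes pow: "\<And>j. P ([:1,1:] ^ j)"
    and add: "\<And>p q. P p \<Longrightarrow> P q \<Longrightarrow> P (p + q)"
    and sm: "\<And>a p. P p \<Longrightarrow> P (Polynomial.smult a p)"
  shows "P r"
proof -
  have "P ([:1,1:] ^ j * r)" for j
  proof (induction r arbitrary: j)
    case 0
    then show ?case using sm[OF pow, of 0] by simp
  next
    case (pCons a r)
    have "[:1,1:] ^ j * pCons a r = Polynomial.smult a ([:1,1:] ^ j) + ([:1,1:] ^ (Suc j) * r + Polynomial.smult (-1) ([:1,1:] ^ j * r))"
    proof -
      have "pCons a r = [:a:] + [:0,1:] * r" by simp
      moreover have "[:0,1:] = [:1,1:] - (1::real poly)" by (simp add: one_pCons)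
      ultimately have "pCons a r = [:a:] + [:1,1:] * r - r" by (simp add: algebra_simps)
      then show ?thesis by (simp add: algebra_simps)
    qed
    then show ?case using add[OF sm[OF pow] add[OF pCons.IH sm[OF pCons.IH]]] by metis
  qed
  from this[of 0] show ?thesis by simp
qed

text \<open>Cofactors along row s do not see row s, so the determinant is an explicit linear form in
  \<open>q\<close>.\<close>

lemma det_row_expand:
  fixes A :: "nat \<Rightarrow> nat \<Rightarrow> 'b \<Rightarrow> 'a::comm_ring_1"
  assumes "s < n"
  shows "Determinant.det (mat n n (\<lambda>(i,c). A i c ((r(s := q)) i))) = (\<Sum>c<n. A s c q * Determinant.cofactor (mat n n (\<lambda>(i,c). A i c (r i))) s c)"
proof -
  have "Determinant.cofactor (mat n n (\<lambda>(i,c). A i c ((r(s := q)) i))) s c = Determinant.cofactor (mat n n (\<lambda>(i,c). A i c (r i))) s c" for c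
    by (rule cofactor_row_cong[of _ n]) auto
  then show ?thesis
    using assms by (subst Determinant.laplace_expansion_row[of _ n s]) auto
qed

text \<open>Multilinearity: divisibility by d is preserved under linear combinations in one row. The
  rows are freed one by one, rows from \<open>s\<close> on being powers of 1+x, so that s = n
  imposes nothing.\<close>

lemma dvd_det_expand:
  fixes A :: "nat \<Rightarrow> nat \<Rightarrow> real poly \<Rightarrow> real poly"
  assumes add: "\<And>i c p q. A i c (p + q) = A i c p + A i c q"
    and sm: "\<And>i c a p. A i c (Polynomial.smult a p) = Polynomial.smult a (A i c p)"
    and mon: "\<And>g. d dvd Determinant.det (mat n n (\<lambda>(i,c). A i c ([:1,1:] ^ g i)))"
  shows "d dvd Determinant.det (mat n n (\<lambda>(i,c). A i c (r i)))"
proof -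
  have "\<forall>r. (\<forall>i. s \<le> i \<longrightarrow> i < n \<longrightarrow> (\<exists>j. r i = [:1,1:] ^ j)) \<longrightarrow> d dvd Determinant.det (mat n n (\<lambda>(i,c). A i c (r i)))" for s
  proof (induction s)
    case 0
    show ?case
    proof (intro allI impI)
      fix r :: "nat \<Rightarrow> real poly" assume "\<forall>i. 0 \<le> i \<longrightarrow> i < n \<longrightarrow> (\<exists>j. r i = [:1,1:] ^ j)"
      then obtain g where g: "\<And>i. i < n \<Longrightarrow> r i = [:1,1:] ^ g i" by (metis le0)
      have "mat n n (\<lambda>(i,c). A i c (r i)) = mat n n (\<lambda>(i,c). A i c ([:1,1:] ^ g i))"
        by (rule eq_matI) (auto simp: g)
      then show "d dvd Determinant.det (mat n n (\<lambda>(i,c). A i c (r i)))" using mon by simp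
    qed
  next
    case (Suc s)
    show ?case
    proof (intro allI impI)
      fix r :: "nat \<Rightarrow> real poly" assume r: "\<forall>i. Suc s \<le> i \<longrightarrow> i < n \<longrightarrow> (\<exists>j. r i = [:1,1:] ^ j)"
      show "d dvd Determinant.det (mat n n (\<lambda>(i,c). A i c (r i)))"
      proof (cases "s < n")
        case False
        then show ?thesis using Suc by auto
      next
        case True
        define P where "P q \<longleftrightarrow> d dvd Determinant.det (mat n n (\<lambda>(i,c). A i c ((r(s := q)) i)))" for q
        have "P ([:1,1:] ^ j)" for j
          unfolding P_def using r by (intro Suc.IH[rule_format]) (auto simp: Suc_le_eq)
        moreover have "P (p + q)" if "P p" "P q" for p q
          using that unfolding P_def det_row_expand[OF True] by (simp add: add algebra_simps sum.distrib)
        moreover have "P (Polynomial.smult a p)" if "P p" for a p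
          using that unfolding P_def det_row_expand[OF True] by (simp add: sm dvd_smult flip: smult_sum_right)
        ultimately have "P (r s)" by (rule shifted_power_induct)
        then show ?thesis by (simp add: P_def)
      qed
    qed
  qed
  from this[of n] show ?thesis by auto
qed

lemma dvd_det_seed_entry:
  fixes n :: nat and r :: "nat \<Rightarrow> real poly" and T :: "nat \<Rightarrow> bool"
  defines "k2 \<equiv> card {i. i < n \<and> \<not> T i}"
  shows "[:1,1:] ^ (k2 * (k2 - 1)) dvd Determinant.det (mat n n (\<lambda>(i,c). seed_entry \<beta> (n - 1) (T i) c (r i)))"
  unfolding k2_def by (rule dvd_det_expand) (simp_all only: seed_entry_add seed_entry_smult dvd_det_power_rows)


section \<open>Expansion along the first row as a differential operator\<close>

definition wmat :: "real \<Rightarrow> nat \<Rightarrow> (nat \<Rightarrow> bool) \<Rightarrow> (nat \<Rightarrow> real poly) \<Rightarrow> real poly mat" where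
  "wmat \<beta> k T r = mat k k (\<lambda>(i,c). seed_entry \<beta> (k - 1) (T i) c (r i))"

definition mmat :: "real \<Rightarrow> nat \<Rightarrow> (nat \<Rightarrow> bool) \<Rightarrow> (nat \<Rightarrow> real poly) \<Rightarrow> real poly \<Rightarrow> real poly mat" where
  "mmat \<beta> k T r p = mat (Suc k) (Suc k) (\<lambda>(i,c). if i = 0 then deriv_row c p else seed_entry \<beta> k (T (i - 1)) c (r (i - 1)))"

text \<open>Coefficient of the c-th derivative when \<open>det (mmat \<beta> k T r p)\<close>,
  divided by the power of 1+x, is read as a differential operator in \<open>p\<close>. The cofactors
  ignore the first row, so 0 stands there, and \<open>(-1)^c\<close> is the sign of
  \<open>deriv_row\<close> moved into the coefficient.\<close>

definition bcoef :: "real \<Rightarrow> nat \<Rightarrow> (nat \<Rightarrow> bool) \<Rightarrow> (nat \<Rightarrow> real poly) \<Rightarrow> nat \<Rightarrow> real poly" where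
  "bcoef \<beta> k T r c = (-1) ^ c * (Determinant.cofactor (mmat \<beta> k T r 0) 0 c div
     [:1,1:] ^ (card {i. i < k \<and> \<not> T i} * (card {i. i < k \<and> \<not> T i} - 1)))"

lemma mmat_carrier [simp]: "mmat \<beta> k T r p \<in> carrier_mat (Suc k) (Suc k)"
  by (simp add: mmat_def)

lemma cofactor_mmat: "Determinant.cofactor (mmat \<beta> k T r p) 0 c = Determinant.cofactor (mmat \<beta> k T r 0) 0 c"
  by (rule cofactor_row_cong[of _ "Suc k"]) (auto simp: mmat_def)

lemma det_mmat: "Determinant.det (mmat \<beta> k T r p) = (\<Sum>c<Suc k. deriv_row c p * Determinant.cofactor (mmat \<beta> k T r 0) 0 c)"
proof -
  have "Determinant.det (mmat \<beta> k T r p) = (\<Sum>c<Suc k. mmat \<beta> k T r p $$ (0,c) * Determinant.cofactor (mmat \<beta> k T r p) 0 c)"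
    by (rule Determinant.laplace_expansion_row) auto
  then show ?thesis unfolding cofactor_mmat[of _ _ _ _ p] by (simp add: mmat_def)
qed

text \<open>This is the Laplace expansion of a matrix whose first row repeats the row of seed
  i.\<close>

lemma cofactor_mmat_kills:
  assumes "i < k"
  shows "(\<Sum>c<Suc k. seed_entry \<beta> k (T i) c (r i) * Determinant.cofactor (mmat \<beta> k T r 0) 0 c) = 0"
proof -
  define A where "A = mat (Suc k) (Suc k) (\<lambda>(j,c). if j = 0 then seed_entry \<beta> k (T i) c (r i) else seed_entry \<beta> k (T (j - 1)) c (r (j - 1)))"
  have A: "A \<in> carrier_mat (Suc k) (Suc k)" by (simp add: A_def)
  have "Determinant.det A = 0"
    by (rule Determinant.det_identical_rows[OF A, of 0 "Suc i"]) (use assms in \<open>auto simp: A_def intro!: eq_vecI\<close>)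
  moreover have "Determinant.cofactor A 0 c = Determinant.cofactor (mmat \<beta> k T r 0) 0 c" for c
    by (rule cofactor_row_cong[OF A]) (auto simp: A_def mmat_def)
  ultimately show ?thesis
    using Determinant.laplace_expansion_row[OF A, of 0] by (simp add: A_def)
qed

text \<open>The first row counts as an F1-type row of a matrix of size k + 1, so the number of
  shifted rows stays k2 and the offset k is again the size minus 1.\<close>

lemma dvd_det_mmat:
  fixes k :: nat and T :: "nat \<Rightarrow> bool"
  defines "k2 \<equiv> card {i. i < k \<and> \<not> T i}"
  shows "[:1,1:] ^ (k2 * (k2 - 1)) dvd Determinant.det (mmat \<beta> k T r p)"
proof -
  define T' where "T' i = (if i = 0 then True else T (i - 1))" for i
  define r' where "r' i = (if i = 0 then p else r (i - 1))" for i
  have "{i. i < Suc k \<and> \<not> T' i} = Suc ` {i. i < k \<and> \<not> T i}"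
  proof (intro equalityI subsetI)
    fix x assume "x \<in> {i. i < Suc k \<and> \<not> T' i}"
    then show "x \<in> Suc ` {i. i < k \<and> \<not> T i}" by (cases x) (auto simp: T'_def)
  qed (auto simp: T'_def)
  then have "card {i. i < Suc k \<and> \<not> T' i} = k2" by (simp add: card_image k2_def)
  moreover have "mmat \<beta> k T r p = mat (Suc k) (Suc k) (\<lambda>(i,c). seed_entry \<beta> (Suc k - 1) (T' i) c (r' i))"
    unfolding mmat_def by (rule eq_matI) (auto simp: T'_def r'_def seed_entry_def)
  ultimately show ?thesis using dvd_det_seed_entry[of "Suc k" T' \<beta> r'] by simp
qed

lemma pder_monom_self: "pder c (Polynomial.monom 1 c) = [:fact c:]"
proof (induction c)
  case (Suc c)
  have "pder (Suc c) (Polynomial.monom 1 (Suc c)) = pder c (pderiv (Polynomial.monom 1 (Suc c)))"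
    by (simp only: pder_def funpow_Suc_right o_def)
  also have "pderiv (Polynomial.monom 1 (Suc c)) = Polynomial.smult (real (Suc c)) (Polynomial.monom 1 c)"
    by (simp add: pderiv_monom smult_monom)
  finally show ?case by (simp add: pder_smult Suc algebra_simps)
qed (simp add: pder_def monom_0)

lemma pder_monom_less: "c < d \<Longrightarrow> pder d (Polynomial.monom 1 c) = 0"
proof (induction d)
  case (Suc d)
  then show ?case by (cases "c = d") (auto simp: pder_Suc pder_monom_self pderiv_pCons)
qed simp

lemma deriv_row_monom: "c < d \<Longrightarrow> deriv_row d (Polynomial.monom 1 c) = 0" "deriv_row c (Polynomial.monom 1 c) = [:(-1) ^ c * fact c:]"
  by (auto simp: deriv_row_def pder_monom_less pder_monom_self)

text \<open>Divisibility of the determinant for every polynomial in the first row passes to the cofactors by inserting the monomials of degree 0, 1, ..., c.\<close>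

lemma dvd_cofactor_mmat:
  fixes k :: nat and T :: "nat \<Rightarrow> bool"
  defines "k2 \<equiv> card {i. i < k \<and> \<not> T i}"
  assumes "c \<le> k"
  shows "[:1,1:] ^ (k2 * (k2 - 1)) dvd Determinant.cofactor (mmat \<beta> k T r 0) 0 c"
  using \<open>c \<le> k\<close>
proof (induction c rule: less_induct)
  case (less c)
  define C where "C c = Determinant.cofactor (mmat \<beta> k T r 0) 0 c" for c
  define t :: "real poly" where "t = [:1,1:] ^ (k2 * (k2 - 1))"
  define q :: "real poly" where "q = Polynomial.monom 1 c"
  have "Determinant.det (mmat \<beta> k T r q) = (\<Sum>d<Suc k. deriv_row d q * C d)"
    unfolding det_mmat C_def ..
  also have "\<dots> = (\<Sum>d<Suc c. deriv_row d q * C d)"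
    by (rule sum.mono_neutral_right) (use less.prems in \<open>auto simp: q_def deriv_row_monom\<close>)
  also have "\<dots> = (\<Sum>d<c. deriv_row d q * C d) + Polynomial.smult ((-1) ^ c * fact c) (C c)"
    by (simp add: q_def deriv_row_monom)
  finally have "Polynomial.smult ((-1) ^ c * fact c) (C c) = Determinant.det (mmat \<beta> k T r q) - (\<Sum>d<c. deriv_row d q * C d)"
    by simp
  moreover have "t dvd Determinant.det (mmat \<beta> k T r q)" unfolding t_def k2_def by (rule dvd_det_mmat)
  moreover have "t dvd (\<Sum>d<c. deriv_row d q * C d)"
    by (intro dvd_sum dvd_mult) (use less in \<open>auto simp: t_def C_def\<close>)
  ultimately have "t dvd Polynomial.smult ((-1) ^ c * fact c) (C c)" by (metis dvd_diff)
  then show ?case by (auto simp: t_def C_def dvd_smult_iff)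
qed

text \<open>Divisibility of the single cofactors lets the quotient be formed term by term, with
  coefficients independent of p.\<close>

lemma det_mmat_div:
  fixes k :: nat and T :: "nat \<Rightarrow> bool"
  defines "k2 \<equiv> card {i. i < k \<and> \<not> T i}"
  shows "Determinant.det (mmat \<beta> k T r p) div [:1,1:] ^ (k2 * (k2 - 1)) = (\<Sum>c\<le>k. bcoef \<beta> k T r c * pder c p)"
proof -
  define t :: "real poly" where "t = [:1,1:] ^ (k2 * (k2 - 1))"
  have t0: "t \<noteq> 0" by (simp add: t_def)
  have c: "Determinant.cofactor (mmat \<beta> k T r 0) 0 c = t * ((-1) ^ c * bcoef \<beta> k T r c)" if "c \<le> k" for c
    using dvd_cofactor_mmat[OF that, of T \<beta> r] unfolding bcoef_def t_def k2_def
    by (simp add: mult.assoc[symmetric] flip: power_add)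
  have "Determinant.det (mmat \<beta> k T r p) = (\<Sum>c<Suc k. t * (bcoef \<beta> k T r c * pder c p))"
    unfolding det_mmat
  proof (rule sum.cong)
    fix x assume "x \<in> {..<Suc k}"
    then have "x \<le> k" by simp
    have "deriv_row x p = (-1) ^ x * pder x p" unfolding deriv_row_def
      by (cases "even x") auto
    then show "deriv_row x p * Determinant.cofactor (mmat \<beta> k T r 0) 0 x = t * (bcoef \<beta> k T r x * pder x p)"
      unfolding c[OF \<open>x \<le> k\<close>] by (simp add: algebra_simps flip: power_add)
  qed simp
  also have "\<dots> = t * (\<Sum>c\<le>k. bcoef \<beta> k T r c * pder c p)"
    by (simp only: sum_distrib_left lessThan_Suc_atMost)
  finally show ?thesis using t0 by (simp add: t_def)
qed

lemma bcoef_kills: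
  assumes "i < k"
  shows "(\<Sum>c\<le>k. seed_entry \<beta> k (T i) c (r i) * ((-1) ^ c * bcoef \<beta> k T r c)) = 0"
proof -
  define t :: "real poly" where "t = [:1,1:] ^ (card {i. i < k \<and> \<not> T i} * (card {i. i < k \<and> \<not> T i} - 1))"
  have t0: "t \<noteq> 0" by (simp add: t_def)
  have c: "Determinant.cofactor (mmat \<beta> k T r 0) 0 c = t * ((-1) ^ c * bcoef \<beta> k T r c)" if "c \<le> k" for c
    using dvd_cofactor_mmat[OF that, of T \<beta> r] unfolding bcoef_def t_def
    by (simp add: mult.assoc[symmetric] flip: power_add)
  have "0 = (\<Sum>c<Suc k. seed_entry \<beta> k (T i) c (r i) * Determinant.cofactor (mmat \<beta> k T r 0) 0 c)"
    using cofactor_mmat_kills[OF assms] by metis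
  also have "\<dots> = (\<Sum>c<Suc k. t * (seed_entry \<beta> k (T i) c (r i) * ((-1) ^ c * bcoef \<beta> k T r c)))"
    by (rule sum.cong) (auto simp: c)
  also have "\<dots> = t * (\<Sum>c\<le>k. seed_entry \<beta> k (T i) c (r i) * ((-1) ^ c * bcoef \<beta> k T r c))"
    by (simp only: sum_distrib_left lessThan_Suc_atMost)
  finally show ?thesis using t0 by auto
qed

text \<open>Deleting the first row and the last column leaves W, except that the offset k instead of
  k - 1 gives each shifted row one more factor 1+x. The sign of the cofactor and the one in
  \<open>bcoef\<close> cancel.\<close>

lemma bcoef_top:
  fixes k :: nat and T :: "nat \<Rightarrow> bool"
  defines "k2 \<equiv> card {i. i < k \<and> \<not> T i}"
  shows "bcoef \<beta> k T r k = [:1,1:] ^ k2 * (Determinant.det (wmat \<beta> k T r) div [:1,1:] ^ (k2 * (k2 - 1)))"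
proof -
  define t :: "real poly" where "t = [:1,1:]"
  have d: "mat_delete (mmat \<beta> k T r 0) 0 k = mat k k (\<lambda>(i,c). (if T i then 1 else t) * seed_entry \<beta> (k - 1) (T i) c (r i))"
  proof (rule eq_matI)
    fix i j assume ij: "i < dim_row (mat k k (\<lambda>(i,c). (if T i then 1 else t) * seed_entry \<beta> (k - 1) (T i) c (r i)))"
      "j < dim_col (mat k k (\<lambda>(i,c). (if T i then 1 else t) * seed_entry \<beta> (k - 1) (T i) c (r i)))"
    have "k - j = Suc (k - 1 - j)" using ij by auto
    then show "mat_delete (mmat \<beta> k T r 0) 0 k $$ (i,j) = mat k k (\<lambda>(i,c). (if T i then 1 else t) * seed_entry \<beta> (k - 1) (T i) c (r i)) $$ (i,j)"
      using ij by (simp add: mat_delete_def mmat_def seed_entry_def t_def[symmetric])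
  qed (auto simp: mat_delete_def mmat_def)
  have "prod (\<lambda>i. if T i then 1 else t) {0..<k} = t ^ k2"
  proof -
    have "prod (\<lambda>i. if T i then 1 else t) {0..<k} = prod (\<lambda>i. t) {i. i < k \<and> \<not> T i}"
      by (rule prod.mono_neutral_cong_right) auto
    then show ?thesis by (simp add: k2_def)
  qed
  then have "Determinant.cofactor (mmat \<beta> k T r 0) 0 k = (-1) ^ k * (t ^ k2 * Determinant.det (wmat \<beta> k T r))"
    unfolding Determinant.cofactor_def d det_scale_rows wmat_def by simp
  moreover have "t ^ (k2 * (k2 - 1)) dvd Determinant.det (wmat \<beta> k T r)"
    unfolding wmat_def t_def k2_def by (rule dvd_det_seed_entry)
  ultimately show ?thesis unfolding bcoef_def t_def[symmetric] k2_def[symmetric]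
    by (simp add: div_mult_swap mult.assoc[symmetric] flip: power_add)
qed

section \<open>Darboux transformation of the Jacobi operator\<close>

lemma has_derivative_eq_on_open:
  fixes f g :: "real \<Rightarrow> real"
  assumes "open S" "x \<in> S" "\<And>y. y \<in> S \<Longrightarrow> f y = g y"
    and "(f has_real_derivative f') (at x)" "(g has_real_derivative g') (at x)"
  shows "f' = g'"
proof -
  have "(g has_real_derivative f') (at x)"
    using has_field_derivative_transform_within_open[OF assms(4,1,2)] assms(3) by auto
  then show ?thesis using assms(5) DERIV_unique by blast
qed

text \<open>A function together with all its derivatives as an explicit sequence, so that
  differential operators become algebraic expressions in the members.\<close>

definition jet :: "(nat \<Rightarrow> real \<Rightarrow> real) \<Rightarrow> bool" where
  "jet Y \<longleftrightarrow> (\<forall>c. \<forall>x\<in>{-1<..<1}. (Y c has_real_derivative Y (Suc c) x) (at x))"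

lemma jetD: "jet Y \<Longrightarrow> x \<in> {-1<..<1} \<Longrightarrow> (Y c has_real_derivative Y (Suc c) x) (at x)"
  by (auto simp: jet_def)

lemma jet_zero:
  assumes "jet Y" "\<And>x. x \<in> {-1<..<1} \<Longrightarrow> Y 0 x = 0" "x \<in> {-1<..<1}"
  shows "Y c x = 0"
  using assms(3)
proof (induction c arbitrary: x)
  case (Suc c)
  show ?case
    by (rule has_derivative_eq_on_open[of "{-1<..<1}" x "Y c" "\<lambda>_. 0"]) (use Suc jetD[OF assms(1)] in auto)
qed (use assms in auto)

definition ejet :: "real \<Rightarrow> real \<Rightarrow> real \<Rightarrow> (nat \<Rightarrow> real \<Rightarrow> real) \<Rightarrow> bool" where
  "ejet \<alpha> \<beta> l Y \<longleftrightarrow> jet Y \<and>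
     (\<forall>x\<in>{-1<..<1}. (1 - x\<^sup>2) * Y 2 x + (\<beta> - \<alpha> - (\<alpha> + \<beta> + 2) * x) * Y 1 x = l * Y 0 x)"

text \<open>The eigenvalue equation differentiated c times: each step adds -2x to the first-order
  coefficient and \<alpha> + \<beta> + 2 + 2c to the constant on the right.\<close>

lemma ejet_ode:
  assumes Y: "ejet \<alpha> \<beta> l Y" and "x \<in> {-1<..<1}"
  shows "(1 - x\<^sup>2) * Y (Suc (Suc c)) x + (\<beta> - \<alpha> - (\<alpha> + \<beta> + 2 + 2 * real c) * x) * Y (Suc c) x
      = (l + real c * (real c + \<alpha> + \<beta> + 1)) * Y c x"
  using assms(2)
proof (induction c arbitrary: x)
  case 0
  then show ?case using Y by (auto simp: ejet_def numeral_2_eq_2)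
next
  case (Suc c)
  have J: "jet Y" using Y by (simp add: ejet_def)
  have "(1 - x\<^sup>2) * Y (Suc (Suc (Suc c))) x + (- 2 * x) * Y (Suc (Suc c)) x
      + ((\<beta> - \<alpha> - (\<alpha> + \<beta> + 2 + 2 * real c) * x) * Y (Suc (Suc c)) x + (- (\<alpha> + \<beta> + 2 + 2 * real c)) * Y (Suc c) x)
     = (l + real c * (real c + \<alpha> + \<beta> + 1)) * Y (Suc c) x"
  proof (rule has_derivative_eq_on_open[OF _ Suc.prems Suc.IH])
    show "((\<lambda>x. (1 - x\<^sup>2) * Y (Suc (Suc c)) x + (\<beta> - \<alpha> - (\<alpha> + \<beta> + 2 + 2 * real c) * x) * Y (Suc c) x) has_real_derivative 
      (1 - x\<^sup>2) * Y (Suc (Suc (Suc c))) x + (- 2 * x) * Y (Suc (Suc c)) x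
      + ((\<beta> - \<alpha> - (\<alpha> + \<beta> + 2 + 2 * real c) * x) * Y (Suc (Suc c)) x + (- (\<alpha> + \<beta> + 2 + 2 * real c)) * Y (Suc c) x)) (at x)"
      by (rule derivative_eq_intros jetD[OF J Suc.prems] refl)+ (simp add: algebra_simps)
    show "((\<lambda>x. (l + real c * (real c + \<alpha> + \<beta> + 1)) * Y c x) has_real_derivative (l + real c * (real c + \<alpha> + \<beta> + 1)) * Y (Suc c) x) (at x)"
      by (rule derivative_eq_intros jetD[OF J Suc.prems] refl)+ simp
  qed auto
  then show ?case by (simp add: algebra_simps)
qed

section \<open>Approximation of a function together with its derivatives\<close>

lemma poly_antiderivative:
  fixes q :: "real poly"
  shows "\<exists>Q. pderiv Q = q \<and> poly Q z = 0"
proof -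
  define Q where "Q = (\<Sum>i\<le>degree q. Polynomial.monom (coeff q i / real (Suc i)) (Suc i))"
  have "pderiv Q = (\<Sum>i\<le>degree q. pderiv (Polynomial.monom (coeff q i / real (Suc i)) (Suc i)))"
    unfolding Q_def by (rule pderiv_sum)
  also have "\<dots> = (\<Sum>i\<le>degree q. Polynomial.monom (coeff q i) i)"
    by (rule sum.cong) (auto simp: pderiv_monom)
  also have "\<dots> = q" by (rule poly_as_sum_of_monoms)
  finally have "pderiv (Q - [:poly Q z:]) = q" by (simp add: pderiv_diff pderiv_pCons)
  then show ?thesis by (intro exI[of _ "Q - [:poly Q z:]"]) auto
qed

lemma poly_iterated_antiderivative:
  "\<exists>p. pder k p = q \<and> (\<forall>c<k. poly (pder c p) z = 0)"
proof (induction k arbitrary: q)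
  case 0
  then show ?case by (simp add: pder_def)
next
  case (Suc k)
  obtain Q where Q: "pderiv Q = q" "poly Q z = 0" using poly_antiderivative by blast
  obtain p where "pder k p = Q" "\<forall>c<k. poly (pder c p) z = 0" using Suc by blast
  then show ?case using Q by (intro exI[of _ p]) (auto simp: pder_def less_Suc_eq)
qed

text \<open>Weierstrass is applied to the k-th derivative only; the approximant is integrated k
  times from -1, where all lower derivatives of Y vanish. By the mean value theorem on an interval
  of length at most 2, the error at most doubles with each integration.\<close>

lemma poly_approx_jet:
  fixes Y :: "nat \<Rightarrow> real \<Rightarrow> real"
  assumes cont: "\<And>c. c \<le> k \<Longrightarrow> continuous_on {-1..1} (Y c)"
    and der: "\<And>c x. c < k \<Longrightarrow> x \<in> {-1<..<1} \<Longrightarrow> (Y c has_real_derivative Y (Suc c) x) (at x)"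
    and init: "\<And>c. c < k \<Longrightarrow> Y c (-1) = 0"
    and "\<eta> > 0"
  shows "\<exists>p. \<forall>c\<le>k. \<forall>x\<in>{-1..1}. \<bar>Y c x - poly (pder c p) x\<bar> \<le> 2 ^ (k - c) * \<eta>"
proof -
  obtain g where g: "real_polynomial_function g" "\<And>x. x \<in> {-1..1} \<Longrightarrow> \<bar>Y k x - g x\<bar> < \<eta>"
    using Stone_Weierstrass_real_polynomial_function[OF compact_Icc cont[OF order_refl] \<open>\<eta> > 0\<close>] by blast
  obtain b n where b: "g = (\<lambda>x. \<Sum>i\<le>n. b i * x ^ i)"
    using g(1) by (auto simp: real_polynomial_function_iff_sum)
  define q where "q = (\<Sum>i\<le>n. Polynomial.monom (b i) i)"
  have q: "g = poly q" by (rule ext) (simp add: b q_def poly_sum poly_monom)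
  obtain p where p: "pder k p = q" "\<And>c. c < k \<Longrightarrow> poly (pder c p) (-1) = 0"
    using poly_iterated_antiderivative by blast
  have "\<forall>x\<in>{-1..1}. \<bar>Y c x - poly (pder c p) x\<bar> \<le> 2 ^ (k - c) * \<eta>" if "c \<le> k" for c
    using that
  proof (induction c rule: inc_induct)
    case base
    then show ?case using g(2) p(1) q by (simp add: less_imp_le)
  next
    case (step c)
    show ?case
    proof
      fix x :: real assume x: "x \<in> {-1..1}"
      define F where "F x = Y c x - poly (pder c p) x" for x
      have F0: "F (-1) = 0" using step init p by (simp add: F_def)
      show "\<bar>Y c x - poly (pder c p) x\<bar> \<le> 2 ^ (k - c) * \<eta>"
      proof (cases "x = -1")
        case True
        then show ?thesis using F0 \<open>\<eta> > 0\<close> by (simp add: F_def)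
      next
        case False
        then have x1: "-1 < x" using x by auto
        have dF: "(F has_real_derivative Y (Suc c) y - poly (pder (Suc c) p) y) (at y)" if "-1 < y" "y < x" for y
        proof -
          have "(Y c has_real_derivative Y (Suc c) y) (at y)" by (rule der) (use step that x in auto)
          moreover have "(poly (pder c p) has_real_derivative poly (pder (Suc c) p) y) (at y)"
            using poly_DERIV[of "pder c p" y] by (simp add: pder_def)
          ultimately show ?thesis unfolding F_def by (rule DERIV_diff)
        qed
        have "continuous_on {-1..x} F" unfolding F_def
          by (intro continuous_intros continuous_on_subset[OF cont[of c]]) (use step x in auto)
        moreover have "F differentiable (at y)" if "-1 < y" "y < x" for y
          using dF[OF that] real_differentiable_def by blast
        ultimately have "\<exists>l z. -1 < z \<and> z < x \<and> DERIV F z :> l \<and> F x - F (-1) = (x - (-1)) * l"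
          by (rule MVT[OF x1])
        then obtain l y where y: "-1 < y" "y < x" "DERIV F y :> l" "F x - F (-1) = (x - (-1)) * l"
          by (elim exE conjE)
        have "l = Y (Suc c) y - poly (pder (Suc c) p) y"
          using y(3) dF[OF y(1,2)] DERIV_unique by blast
        then have "\<bar>l\<bar> \<le> 2 ^ (k - Suc c) * \<eta>" using step.IH y x by auto
        then have "\<bar>x - (-1)\<bar> * \<bar>l\<bar> \<le> 2 * (2 ^ (k - Suc c) * \<eta>)"
          using x by (intro mult_mono) auto
        then have "\<bar>F x\<bar> \<le> 2 * (2 ^ (k - Suc c) * \<eta>)"
          using y(4) F0 by (simp only: abs_mult diff_0_right)
        also have "\<dots> = 2 ^ (k - c) * \<eta>" using step by (simp add: Suc_diff_Suc[symmetric] power_Suc[symmetric] del: power_Suc) 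
        finally show ?thesis by (simp add: F_def)
      qed
    qed
  qed
  then show ?thesis by blast
qed

text \<open>J i c is the c-th derivative of the i-th seed, V the inverse of the matrix of J i c for i, c < k, and the operator with coefficients B c kills the seeds. The seeds need only be smooth to the right of -1, but up to and beyond 1.\<close>

locale darboux =
  fixes k :: nat and J :: "nat \<Rightarrow> nat \<Rightarrow> real \<Rightarrow> real" and V :: "nat \<Rightarrow> nat \<Rightarrow> real \<Rightarrow> real"
    and B :: "nat \<Rightarrow> real poly" and \<alpha> \<beta> :: real and \<mu> :: "nat \<Rightarrow> real"
  assumes J_deriv: "\<And>i c x. i < k \<Longrightarrow> -1 < x \<Longrightarrow> (J i c has_real_derivative J i (Suc c) x) (at x)"
    and J_ode: "\<And>i x. i < k \<Longrightarrow> x \<in> {-1<..<1} \<Longrightarrow>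
       (1 - x\<^sup>2) * J i 2 x + (\<beta> - \<alpha> - (\<alpha> + \<beta> + 2) * x) * J i 1 x = \<mu> i * J i 0 x"
    and kills: "\<And>i x. i < k \<Longrightarrow> x \<in> {-1<..<1} \<Longrightarrow> (\<Sum>c\<le>k. poly (B c) x * J i c x) = 0"
    and B_top: "\<And>x. x \<in> {-1<..<1} \<Longrightarrow> poly (B k) x \<noteq> 0"
    and V_diff: "\<And>c i x. c < k \<Longrightarrow> i < k \<Longrightarrow> x \<in> {-1<..<1} \<Longrightarrow> \<exists>D. (V c i has_real_derivative D) (at x)"
    and VJ: "\<And>c c' x. c < k \<Longrightarrow> c' < k \<Longrightarrow> x \<in> {-1<..<1} \<Longrightarrow> (\<Sum>i<k. V c i x * J i c' x) = (if c = c' then 1 else 0)"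
    and JV: "\<And>i i' x. i < k \<Longrightarrow> i' < k \<Longrightarrow> x \<in> {-1<..<1} \<Longrightarrow> (\<Sum>c<k. J i c x * V c i' x) = (if i = i' then 1 else 0)"
begin

text \<open>Coefficients of the monic operator. \<open>a1\<close> and \<open>a2\<close> are their
  first two derivatives in closed form, \<open>N c\<close> being the numerator from the quotient
  rule.\<close>

definition a :: "nat \<Rightarrow> real \<Rightarrow> real" where "a c x = poly (B c) x / poly (B k) x"
definition N :: "nat \<Rightarrow> real poly" where "N c = pderiv (B c) * B k - B c * pderiv (B k)"
definition a1 :: "nat \<Rightarrow> real \<Rightarrow> real" where "a1 c x = poly (N c) x / poly (B k) x ^ 2"
definition a2 :: "nat \<Rightarrow> real \<Rightarrow> real" where
  "a2 c x = (poly (pderiv (N c)) x * poly (B k) x ^ 2 - poly (N c) x * (2 * poly (B k) x * poly (pderiv (B k)) x)) / poly (B k) x ^ 4"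

lemma a_deriv: "x \<in> {-1<..<1} \<Longrightarrow> (a c has_real_derivative a1 c x) (at x)"
  unfolding a_def a1_def using B_top[of x]
  by (auto intro!: derivative_eq_intros simp: N_def power2_eq_square algebra_simps)

lemma a1_deriv: "x \<in> {-1<..<1} \<Longrightarrow> (a1 c has_real_derivative a2 c x) (at x)"
  unfolding a1_def a2_def using B_top[of x]
  by (auto intro!: derivative_eq_intros simp: power2_eq_square eval_nat_numeral algebra_simps)

lemma a_top: "x \<in> {-1<..<1} \<Longrightarrow> a k x = 1" "a1 k x = 0" "a2 k x = 0"
  using B_top[of x] by (auto simp: a_def a1_def a2_def N_def)

definition psi :: "(nat \<Rightarrow> real \<Rightarrow> real) \<Rightarrow> real \<Rightarrow> real" where
  "psi Y x = (\<Sum>c\<le>k. a c x * Y c x)"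
definition psi1 :: "(nat \<Rightarrow> real \<Rightarrow> real) \<Rightarrow> real \<Rightarrow> real" where
  "psi1 Y x = (\<Sum>c\<le>k. a1 c x * Y c x + a c x * Y (Suc c) x)"
definition psi2 :: "(nat \<Rightarrow> real \<Rightarrow> real) \<Rightarrow> real \<Rightarrow> real" where
  "psi2 Y x = (\<Sum>c\<le>k. a2 c x * Y c x + 2 * a1 c x * Y (Suc c) x + a c x * Y (Suc (Suc c)) x)"

lemma psi_deriv:
  assumes "jet Y" "x \<in> {-1<..<1}"
  shows "(psi Y has_real_derivative psi1 Y x) (at x)"
proof -
  have "((\<lambda>x. \<Sum>c\<le>k. a c x * Y c x) has_real_derivative (\<Sum>c\<le>k. a1 c x * Y c x + Y (Suc c) x * a c x)) (at x)"
    by (intro DERIV_sum DERIV_mult a_deriv jetD assms)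
  then show ?thesis unfolding psi_def psi1_def by (simp add: mult.commute)
qed

lemma psi1_deriv:
  assumes "jet Y" "x \<in> {-1<..<1}"
  shows "(psi1 Y has_real_derivative psi2 Y x) (at x)"
proof -
  have "((\<lambda>x. \<Sum>c\<le>k. a1 c x * Y c x + a c x * Y (Suc c) x) has_real_derivative
     (\<Sum>c\<le>k. (a2 c x * Y c x + Y (Suc c) x * a1 c x) + (a1 c x * Y (Suc c) x + Y (Suc (Suc c)) x * a c x))) (at x)"
    by (intro DERIV_sum DERIV_add DERIV_mult a_deriv a1_deriv jetD assms)
  then show ?thesis unfolding psi1_def psi2_def by (simp add: algebra_simps)
qed

section \<open>Intertwining with the transformed second-order operator\<close>

definition u :: "nat \<Rightarrow> real \<Rightarrow> real" where
  "u c x = 2 * (real k - real c) * x * a c x - 2 * (1 - x\<^sup>2) * a1 c x"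
definition w :: "nat \<Rightarrow> real \<Rightarrow> real" where
  "w c x = - real c * (real c + \<alpha> + \<beta> + 1) * a c x - (1 - x\<^sup>2) * a2 c x
     - (\<beta> - \<alpha> - (\<alpha> + \<beta> + 2 + 2 * real k) * x) * a1 c x"
text \<open>Term c of the residual contributes \<open>u c\<close> to the derivative of order c + 1
  and \<open>w c\<close> to that of order c; \<open>e\<close> sorts these by order.\<close>

definition e :: "nat \<Rightarrow> real \<Rightarrow> real" where
  "e c x = (if c = 0 then 0 else u (c - 1) x) + w c x"

text \<open>Since \<open>l * psi Y\<close> is psi applied to the Jacobi operator on Y, this is the
  defect of intertwining. The second-order parts cancel termwise, and the shift 2kx in the new
  first-order coefficient is what makes \<open>u k\<close> vanish, so no derivative of order k + 1
  remains.\<close>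

lemma residual:
  assumes Y: "ejet \<alpha> \<beta> l Y" and x: "x \<in> {-1<..<1}"
  shows "l * psi Y x - (1 - x\<^sup>2) * psi2 Y x - (\<beta> - \<alpha> - (\<alpha> + \<beta> + 2 + 2 * real k) * x) * psi1 Y x
    = (\<Sum>c\<le>k. e c x * Y c x)"
proof -
  let ?q = "\<beta> - \<alpha> - (\<alpha> + \<beta> + 2 + 2 * real k) * x"
  have "l * psi Y x - (1 - x\<^sup>2) * psi2 Y x - ?q * psi1 Y x
    = (\<Sum>c\<le>k. a c x * (l * Y c x) - (1 - x\<^sup>2) * (a2 c x * Y c x + 2 * a1 c x * Y (Suc c) x + a c x * Y (Suc (Suc c)) x)
       - ?q * (a1 c x * Y c x + a c x * Y (Suc c) x))"
    unfolding psi_def psi1_def psi2_def sum_distrib_left sum_subtractf by (simp add: mult_ac)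
  also have "\<dots> = (\<Sum>c\<le>k. u c x * Y (Suc c) x + w c x * Y c x)"
  proof (rule sum.cong)
    fix c
    have l: "l * Y c x = (1 - x\<^sup>2) * Y (Suc (Suc c)) x + (\<beta> - \<alpha> - (\<alpha> + \<beta> + 2 + 2 * real c) * x) * Y (Suc c) x
       - real c * (real c + \<alpha> + \<beta> + 1) * Y c x"
      using ejet_ode[OF Y x, of c] by (simp add: algebra_simps)
    show "a c x * (l * Y c x) - (1 - x\<^sup>2) * (a2 c x * Y c x + 2 * a1 c x * Y (Suc c) x + a c x * Y (Suc (Suc c)) x)
       - ?q * (a1 c x * Y c x + a c x * Y (Suc c) x) = u c x * Y (Suc c) x + w c x * Y c x"
      unfolding l u_def w_def by (simp add: algebra_simps)
  qed simp
  also have "\<dots> = (\<Sum>c\<le>k. u c x * Y (Suc c) x) + (\<Sum>c\<le>k. w c x * Y c x)"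
    by (rule sum.distrib)
  also have "(\<Sum>c\<le>k. u c x * Y (Suc c) x) = (\<Sum>c<k. u c x * Y (Suc c) x)"
    by (simp add: lessThan_Suc_atMost[symmetric] u_def a_top)
  also have "\<dots> = (\<Sum>c\<le>k. (if c = 0 then 0 else u (c - 1) x) * Y c x)"
    by (simp add: lessThan_Suc_atMost[symmetric] sum.lessThan_Suc_shift del: sum.lessThan_Suc)
  finally show ?thesis by (simp add: e_def algebra_simps sum.distrib)
qed

lemma J_jet: "i < k \<Longrightarrow> jet (J i)"
  using J_deriv by (auto simp: jet_def)

lemma J_ejet: "i < k \<Longrightarrow> ejet \<alpha> \<beta> (\<mu> i) (J i)"
  using J_jet J_ode by (auto simp: ejet_def)

lemma psi_J: "i < k \<Longrightarrow> x \<in> {-1<..<1} \<Longrightarrow> psi (J i) x = 0"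
proof -
  assume "i < k" "x \<in> {-1<..<1}"
  then have "(\<Sum>c\<le>k. poly (B c) x * J i c x) / poly (B k) x = 0" using kills by simp
  then show ?thesis by (simp add: psi_def a_def sum_divide_distrib)
qed

lemma psi1_J: "i < k \<Longrightarrow> x \<in> {-1<..<1} \<Longrightarrow> psi1 (J i) x = 0"
  by (rule has_derivative_eq_on_open[of "{-1<..<1}" x "psi (J i)" "\<lambda>_. 0"])
    (use psi_J psi_deriv[OF J_jet] in auto)

lemma psi2_J: "i < k \<Longrightarrow> x \<in> {-1<..<1} \<Longrightarrow> psi2 (J i) x = 0"
  by (rule has_derivative_eq_on_open[of "{-1<..<1}" x "psi1 (J i)" "\<lambda>_. 0"])
    (use psi1_J psi1_deriv[OF J_jet] in auto)

text \<open>An operator of order less than k that kills the seeds at x is a coefficient vector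
  annihilated by the seed matrix; multiplication by \<open>V\<close> recovers the vector.\<close>

lemma order_lt_zero:
  assumes x: "x \<in> {-1<..<1}" and z: "\<And>i. i < k \<Longrightarrow> (\<Sum>c<k. d c * J i c x) = 0" and c: "c < k"
  shows "d c = 0"
proof -
  have "d c = (\<Sum>c'<k. d c' * (if c = c' then 1 else 0))"
    using c by (simp add: if_distrib cong: if_cong)
  also have "\<dots> = (\<Sum>c'<k. d c' * (\<Sum>i<k. V c i x * J i c' x))"
    by (rule sum.cong) (auto simp: VJ[OF c _ x])
  also have "\<dots> = (\<Sum>c'<k. \<Sum>i<k. V c i x * (d c' * J i c' x))"
    by (simp add: sum_distrib_left mult_ac)
  also have "\<dots> = (\<Sum>i<k. \<Sum>c'<k. V c i x * (d c' * J i c' x))"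
    by (rule sum.swap)
  also have "\<dots> = (\<Sum>i<k. V c i x * (\<Sum>c'<k. d c' * J i c' x))"
    by (simp add: sum_distrib_left)
  also have "\<dots> = 0" by (simp add: z)
  finally show ?thesis .
qed

text \<open>The same with \<open>V\<close> on the other side: the seeds are independent already
  through their derivatives of order less than k at a single point.\<close>

lemma coeff_zero:
  assumes x: "x \<in> {-1<..<1}" and z: "\<And>c. c < k \<Longrightarrow> (\<Sum>i<k. d i * J i c x) = 0" and i: "i < k"
  shows "d i = 0"
proof -
  have "d i = (\<Sum>i'<k. d i' * (if i' = i then 1 else 0))"
    using i by (simp add: if_distrib cong: if_cong)
  also have "\<dots> = (\<Sum>i'<k. d i' * (\<Sum>c<k. J i' c x * V c i x))"
    by (rule sum.cong) (auto simp: JV[OF _ i x])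
  also have "\<dots> = (\<Sum>i'<k. \<Sum>c<k. V c i x * (d i' * J i' c x))"
    by (simp add: sum_distrib_left mult_ac)
  also have "\<dots> = (\<Sum>c<k. \<Sum>i'<k. V c i x * (d i' * J i' c x))"
    by (rule sum.swap)
  also have "\<dots> = (\<Sum>c<k. V c i x * (\<Sum>i'<k. d i' * J i' c x))"
    by (simp add: sum_distrib_left)
  also have "\<dots> = 0" by (simp add: z)
  finally show ?thesis .
qed

lemma sum_atMost_top: "(\<Sum>c\<le>k. f c) = (\<Sum>c<k. f c) + (f k :: real)"
  by (simp add: lessThan_Suc_atMost[symmetric])

text \<open>The residual is an operator of order at most k; since it kills the seeds, subtracting e k times psi leaves an operator of order less than k that kills them, hence zero.\<close>

lemma residual_coeff_eq:
  assumes x: "x \<in> {-1<..<1}" and c: "c \<le> k"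
  shows "e c x = e k x * a c x"
proof (cases "c = k")
  case True
  then show ?thesis using a_top x by simp
next
  case False
  have "e c x - e k x * a c x = 0"
  proof (rule order_lt_zero[OF x, where d = "\<lambda>c. e c x - e k x * a c x"])
    fix i assume i: "i < k"
    have "(\<Sum>c\<le>k. e c x * J i c x) = 0"
      using residual[OF J_ejet[OF i] x] psi_J[OF i x] psi1_J[OF i x] psi2_J[OF i x] by simp
    then have s1: "(\<Sum>c<k. e c x * J i c x) + e k x * J i k x = 0" by (simp only: sum_atMost_top)
    have "(\<Sum>c\<le>k. a c x * J i c x) = 0" using psi_J[OF i x] by (simp add: psi_def)
    then have s2: "(\<Sum>c<k. a c x * J i c x) + J i k x = 0" by (simp add: sum_atMost_top a_top(1)[OF x])
    have "(\<Sum>c<k. e c x * J i c x) - e k x * (\<Sum>c<k. a c x * J i c x)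
      = ((\<Sum>c<k. e c x * J i c x) + e k x * J i k x) - e k x * ((\<Sum>c<k. a c x * J i c x) + J i k x)"
      by (simp add: algebra_simps)
    also have "\<dots> = 0" unfolding s1 s2 by simp
    finally have "(\<Sum>c<k. e c x * J i c x) - e k x * (\<Sum>c<k. a c x * J i c x) = 0" .
    then show "(\<Sum>c<k. (e c x - e k x * a c x) * J i c x) = 0"
      by (simp only: left_diff_distrib sum_subtractf sum_distrib_left mult.assoc)
  qed (use c False in auto)
  then show ?thesis by simp
qed

text \<open>The potential r of the new operator is \<open>e k\<close>. It does not involve l, so it
  cancels between two eigenfunctions.\<close>

lemma psi_ode:
  assumes Y: "ejet \<alpha> \<beta> l Y" and x: "x \<in> {-1<..<1}"
  shows "(1 - x\<^sup>2) * psi2 Y x + (\<beta> - \<alpha> - (\<alpha> + \<beta> + 2 + 2 * real k) * x) * psi1 Y x = (l - e k x) * psi Y x"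
proof -
  have "(\<Sum>c\<le>k. e c x * Y c x) = (\<Sum>c\<le>k. e k x * a c x * Y c x)"
    by (rule sum.cong[OF refl], subst residual_coeff_eq[OF x]) auto
  also have "\<dots> = e k x * psi Y x"
    by (simp add: psi_def sum_distrib_left mult_ac)
  finally show ?thesis
    using residual[OF Y x] unfolding left_diff_distrib[of l] by linarith
qed

text \<open>Lagrange's identity: the derivative of the factor in front is the weight times the
  first-order coefficient, so differentiating produces a combination of the two equations in which
  only l - m survives.\<close>

lemma wronskian_deriv:
  assumes Y: "ejet \<alpha> \<beta> l Y" and Z: "ejet \<alpha> \<beta> m Z" and x: "x \<in> {-1<..<1}"
  shows "((\<lambda>x. (1 - x) powr (\<alpha> + real k + 1) * (1 + x) powr (\<beta> + real k + 1) * (psi1 Y x * psi Z x - psi Y x * psi1 Z x))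
     has_real_derivative (l - m) * ((1 - x) powr (\<alpha> + real k) * (1 + x) powr (\<beta> + real k) * (psi Y x * psi Z x))) (at x)"
proof -
  have jY: "jet Y" and jZ: "jet Z" using Y Z by (auto simp: ejet_def)
  define A where "A = (1 - x) powr (\<alpha> + real k)"
  define C where "C = (1 + x) powr (\<beta> + real k)"
  have A: "(1 - x) powr (\<alpha> + real k + 1) = (1 - x) * A" 
    using x by (simp add: A_def powr_add)
  have C: "(1 + x) powr (\<beta> + real k + 1) = (1 + x) * C" 
    using x by (simp add: C_def powr_add)
  have dA: "((\<lambda>x. (1 - x) powr (\<alpha> + real k + 1)) has_real_derivative - (\<alpha> + real k + 1) * A) (at x)"
    unfolding A_def using x by (auto intro!: derivative_eq_intros simp: algebra_simps)
  have dC: "((\<lambda>x. (1 + x) powr (\<beta> + real k + 1)) has_real_derivative (\<beta> + real k + 1) * C) (at x)"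
    unfolding C_def using x by (auto intro!: derivative_eq_intros simp: algebra_simps)
  have d: "((\<lambda>x. (1 - x) powr (\<alpha> + real k + 1) * (1 + x) powr (\<beta> + real k + 1) * (psi1 Y x * psi Z x - psi Y x * psi1 Z x))
     has_real_derivative 
      (- (\<alpha> + real k + 1) * A * ((1 + x) * C) + (\<beta> + real k + 1) * C * ((1 - x) * A)) * (psi1 Y x * psi Z x - psi Y x * psi1 Z x)
      + (psi2 Y x * psi Z x + psi1 Z x * psi1 Y x - (psi1 Y x * psi1 Z x + psi2 Z x * psi Y x)) * (((1 - x) * A) * ((1 + x) * C))) (at x)"
    unfolding A[symmetric] C[symmetric]
    by (intro DERIV_mult DERIV_diff dA dC psi_deriv psi1_deriv jY jZ x)
  have "(- (\<alpha> + real k + 1) * A * ((1 + x) * C) + (\<beta> + real k + 1) * C * ((1 - x) * A)) * (psi1 Y x * psi Z x - psi Y x * psi1 Z x)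
      + (psi2 Y x * psi Z x + psi1 Z x * psi1 Y x - (psi1 Y x * psi1 Z x + psi2 Z x * psi Y x)) * (((1 - x) * A) * ((1 + x) * C))
    = A * C * (psi Z x * ((1 - x\<^sup>2) * psi2 Y x + (\<beta> - \<alpha> - (\<alpha> + \<beta> + 2 + 2 * real k) * x) * psi1 Y x)
       - psi Y x * ((1 - x\<^sup>2) * psi2 Z x + (\<beta> - \<alpha> - (\<alpha> + \<beta> + 2 + 2 * real k) * x) * psi1 Z x))"
    by (simp add: algebra_simps power2_eq_square)
  also have "\<dots> = (l - m) * (A * C * (psi Y x * psi Z x))"
    unfolding psi_ode[OF Y x] psi_ode[OF Z x] by (simp add: algebra_simps)
  finally show ?thesis using DERIV_cong[OF d] unfolding A_def C_def by blast
qed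

section \<open>Kernel of psi\<close>

lemma jet_minus_combination:
  assumes "jet Y" 
  shows "jet (\<lambda>c x. Y c x - (\<Sum>i<k. d i * J i c x))"
  unfolding jet_def
proof (intro allI ballI)
  fix c x assume x: "x \<in> {-1<..<1::real}"
  show "((\<lambda>x. Y c x - (\<Sum>i<k. d i * J i c x)) has_real_derivative Y (Suc c) x - (\<Sum>i<k. d i * J i (Suc c) x)) (at x)"
    by (intro DERIV_diff DERIV_sum DERIV_cmult jetD[OF assms] J_deriv) (use x in auto)
qed

text \<open>The coefficients v i that represent the derivatives of Y of order less than k by those of the seeds also represent the k-th one, so differentiating shows that they are constant.\<close>

lemma kernel:
  assumes Y: "jet Y" and z: "\<And>x. x \<in> {-1<..<1} \<Longrightarrow> psi Y x = 0"
  shows "\<exists>d. \<forall>x\<in>{-1<..<1}. Y 0 x = (\<Sum>i<k. d i * J i 0 x)"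
proof -
  define v where "v i x = (\<Sum>c<k. Y c x * V c i x)" for i x
  have v1: "Y c x = (\<Sum>i<k. v i x * J i c x)" if x: "x \<in> {-1<..<1}" and c: "c < k" for c x
  proof -
    have "(\<Sum>i<k. v i x * J i c x) = (\<Sum>i<k. \<Sum>c'<k. Y c' x * (V c' i x * J i c x))"
      by (simp add: v_def sum_distrib_left sum_distrib_right mult_ac)
    also have "\<dots> = (\<Sum>c'<k. \<Sum>i<k. Y c' x * (V c' i x * J i c x))" by (rule sum.swap)
    also have "\<dots> = (\<Sum>c'<k. Y c' x * (\<Sum>i<k. V c' i x * J i c x))" by (simp add: sum_distrib_left)
    also have "\<dots> = (\<Sum>c'<k. Y c' x * (if c' = c then 1 else 0))"
      by (rule sum.cong) (auto simp: VJ[OF _ c x])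
    also have "\<dots> = Y c x" using c by (simp add: if_distrib cong: if_cong)
    finally show ?thesis by simp
  qed
  \<comment> \<open>psi is monic and kills Y and the seeds, so all k-th derivatives depend on the
    lower ones by the same formula.\<close>
  have v2: "Y k x = (\<Sum>i<k. v i x * J i k x)" if x: "x \<in> {-1<..<1}" for x
  proof -
    have Jk: "J i k x = - (\<Sum>c<k. a c x * J i c x)" if "i < k" for i
      using psi_J[OF that x] by (simp add: psi_def sum_atMost_top a_top(1)[OF x])
    have "Y k x = - (\<Sum>c<k. a c x * Y c x)"
      using z[OF x] by (simp add: psi_def sum_atMost_top a_top(1)[OF x])
    also have "\<dots> = - (\<Sum>c<k. \<Sum>i<k. v i x * (a c x * J i c x))"
      by (simp add: v1[OF x] sum_distrib_left mult_ac)
    also have "\<dots> = - (\<Sum>i<k. \<Sum>c<k. v i x * (a c x * J i c x))" by (subst sum.swap) simp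
    also have "\<dots> = (\<Sum>i<k. v i x * J i k x)" by (simp add: Jk sum_distrib_left sum_negf)
    finally show ?thesis .
  qed
  have v: "Y c x = (\<Sum>i<k. v i x * J i c x)" if x: "x \<in> {-1<..<1}" and c: "c \<le> k" for c x
    using v1[OF x] v2[OF x] c by (cases "c = k") auto
  have "\<exists>D. (v i has_real_derivative D) (at x)" if x: "x \<in> {-1<..<1}" and i: "i < k" for i x
  proof -
    have "\<forall>c. \<exists>D. c < k \<longrightarrow> (V c i has_real_derivative D) (at x)" using V_diff i x by auto
    then obtain D where D: "\<And>c. c < k \<Longrightarrow> (V c i has_real_derivative D c) (at x)" by metis
    have "((\<lambda>x. \<Sum>c<k. Y c x * V c i x) has_real_derivative (\<Sum>c<k. Y (Suc c) x * V c i x + D c * Y c x)) (at x)"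
      by (intro DERIV_sum DERIV_mult jetD[OF Y x] D) auto
    then show ?thesis unfolding v_def by blast
  qed
  then have ex: "\<exists>D. (v i has_real_derivative D) (at x)" if "x \<in> {-1<..<1}" "i < k" for i x
    using that by blast
  define v' where "v' i x = (SOME D. (v i has_real_derivative D) (at x))" for i x
  have v': "(v i has_real_derivative v' i x) (at x)" if "x \<in> {-1<..<1}" "i < k" for i x
    unfolding v'_def by (rule someI_ex[OF ex[OF that]])
  have v'0: "v' i x = 0" if x: "x \<in> {-1<..<1}" and i: "i < k" for i x
  proof (rule coeff_zero[OF x _ i, where d = "\<lambda>i. v' i x"])
    fix c assume c: "c < k"
    have "Y (Suc c) x = (\<Sum>i<k. v' i x * J i c x + J i (Suc c) x * v i x)"
      by (rule has_derivative_eq_on_open[of "{-1<..<1}" x "Y c" "\<lambda>x. \<Sum>i<k. v i x * J i c x"])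
        (use x c in \<open>auto intro!: DERIV_sum DERIV_mult v' jetD[OF Y] J_deriv v\<close>)
    moreover have "Y (Suc c) x = (\<Sum>i<k. v i x * J i (Suc c) x)" using v[OF x, of "Suc c"] c by simp
    ultimately show "(\<Sum>i<k. v' i x * J i c x) = 0" by (simp add: sum.distrib mult.commute)
  qed
  have "\<exists>d. \<forall>x\<in>{-1<..<1}. v i x = d" if i: "i < k" for i
  proof -
    have "\<exists>c. \<forall>x\<in>{-1<..<1}. v i x = c"
      by (rule has_field_derivative_zero_constant)
        (use v' v'0 i in \<open>auto intro: has_field_derivative_at_within simp del: greaterThanLessThan_iff\<close>)
    then show ?thesis .
  qed
  then obtain d where d: "\<And>i x. i < k \<Longrightarrow> x \<in> {-1<..<1} \<Longrightarrow> v i x = d i" by metis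
  have "Y 0 x = (\<Sum>i<k. d i * J i 0 x)" if x: "x \<in> {-1<..<1}" for x
    using v[OF x, of 0] by (simp add: d[OF _ x])
  then show ?thesis by blast
qed

text \<open>Such a Y is a combination of seeds, and its eigenvalue equation turns into a vanishing
  combination with coefficients \<open>d i * (l - \<mu> i)\<close>. Independence of the seeds makes
  these products 0.\<close>

lemma kernel_eigen:
  assumes Y: "ejet \<alpha> \<beta> l Y" and z: "\<And>x. x \<in> {-1<..<1} \<Longrightarrow> psi Y x = 0"
    and l: "\<And>i. i < k \<Longrightarrow> l \<noteq> \<mu> i" and x0: "x \<in> {-1<..<1}"
  shows "Y 0 x = 0"
proof -
  have jY: "jet Y" using Y by (auto simp: ejet_def)
  obtain d where d: "\<And>x. x \<in> {-1<..<1} \<Longrightarrow> Y 0 x = (\<Sum>i<k. d i * J i 0 x)"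
    using kernel[OF jY z] by blast
  have Yd: "Y c x = (\<Sum>i<k. d i * J i c x)" if x: "x \<in> {-1<..<1}" for c x
    using jet_zero[OF jet_minus_combination[OF jY, of d] _ x, of c] d by simp
  have e: "(\<Sum>i<k. d i * (l - \<mu> i) * J i 0 x) = 0" if x: "x \<in> {-1<..<1}" for x
  proof -
    have "l * (\<Sum>i<k. d i * J i 0 x) = (1 - x\<^sup>2) * Y 2 x + (\<beta> - \<alpha> - (\<alpha> + \<beta> + 2) * x) * Y 1 x"
      using Y x Yd[OF x, of 0] unfolding ejet_def by simp
    also have "\<dots> = (\<Sum>i<k. d i * ((1 - x\<^sup>2) * J i 2 x + (\<beta> - \<alpha> - (\<alpha> + \<beta> + 2) * x) * J i 1 x))"
      unfolding Yd[OF x] by (simp add: sum_distrib_left algebra_simps flip: sum.distrib)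
    also have "\<dots> = (\<Sum>i<k. d i * (\<mu> i * J i 0 x))"
      by (rule sum.cong) (use J_ode x in auto)
    finally have "(\<Sum>i<k. l * (d i * J i 0 x)) - (\<Sum>i<k. d i * (\<mu> i * J i 0 x)) = 0"
      by (simp add: sum_distrib_left)
    then show ?thesis unfolding sum_subtractf[symmetric] by (simp add: algebra_simps)
  qed
  have "d i * (l - \<mu> i) = 0" if i: "i < k" for i
  proof (rule coeff_zero[OF x0 _ i, where d = "\<lambda>i. d i * (l - \<mu> i)"])
    fix c
    \<comment> \<open>Subtracting the combination from the zero jet gives a jet, so its derivatives
      vanish along with it, as \<open>coeff_zero\<close> requires.\<close>
    have j0: "jet (\<lambda>_ _. 0)" by (auto simp: jet_def)
    show "(\<Sum>i<k. d i * (l - \<mu> i) * J i c x) = 0"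
      using jet_zero[OF jet_minus_combination[OF j0, of "\<lambda>i. d i * (l - \<mu> i)"] _ x0, of c] e by simp
  qed
  then have "d i = 0" if "i < k" for i using l[OF that] that by auto
  then show ?thesis using d[OF x0] by simp
qed


section \<open>Uniform approximation by variation of parameters\<close>

lemma uniform_approximation:
  fixes h :: "real \<Rightarrow> real"
  assumes h: "continuous_on UNIV h" and k: "0 < k" and \<delta>: "0 < \<delta>" "\<delta> < 1"
    and supp: "\<And>x. \<bar>x\<bar> > 1 - \<delta> \<Longrightarrow> h x = 0" and \<epsilon>: "\<epsilon> > 0"
  shows "\<exists>p. \<forall>x\<in>{-1<..<1}. \<bar>h x - poly (\<Sum>c\<le>k. B c * pder c p) x\<bar> < \<epsilon>"
proof -
  \<comment> \<open>Division by \<open>B k\<close> makes the equation monic. The value 0 outside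
    (-1,1) is a continuous extension because h vanishes near both ends.\<close>
  define hh where "hh x = (if x \<in> {-1<..<1} then h x / poly (B k) x else 0)" for x
  \<comment> \<open>Row k - 1 of \<open>V\<close>: paired with the seed derivatives, the derivatives
    of the parameters must give 0 below order k - 1 and \<open>hh\<close> at order k - 1.\<close>
  define g where "g i x = (if x \<in> {-1<..<1} then V (k - 1) i x * hh x else 0)" for i x
  have split: "UNIV = {-1<..<1} \<union> ({..< -1 + \<delta>} \<union> {1 - \<delta><..})" using \<delta> by auto
  have h0: "h x = 0" if "x \<in> {..< -1 + \<delta>} \<union> {1 - \<delta><..}" for x
    using supp[of x] that by auto
  have conthh: "continuous_on UNIV hh"
    unfolding split
  proof (rule continuous_on_open_Un)
    have "continuous_on {-1<..<1} (\<lambda>x. h x / poly (B k) x)"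
      by (intro continuous_intros continuous_on_subset[OF h]) (use B_top in auto)
    then show "continuous_on {-1<..<1} hh" by (rule continuous_on_eq) (auto simp: hh_def)
    have "continuous_on ({..< -1 + \<delta>} \<union> {1 - \<delta><..}) (\<lambda>x. 0::real)" by simp
    then show "continuous_on ({..< -1 + \<delta>} \<union> {1 - \<delta><..}) hh" by (rule continuous_on_eq) (auto simp: hh_def h0)
  qed auto
  have contg: "continuous_on UNIV (g i)" if i: "i < k" for i
    unfolding split
  proof (rule continuous_on_open_Un)
    have "isCont (V (k - 1) i) x" if "x \<in> {-1<..<1}" for x
      using V_diff[of "k - 1" i x] i that DERIV_isCont by force
    then have "continuous_on {-1<..<1} (V (k - 1) i)" by (simp add: continuous_at_imp_continuous_on)
    then have "continuous_on {-1<..<1} (\<lambda>x. V (k - 1) i x * hh x)"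
      by (intro continuous_intros continuous_on_subset[OF conthh]) auto
    then show "continuous_on {-1<..<1} (g i)" by (rule continuous_on_eq) (auto simp: g_def)
    have "continuous_on ({..< -1 + \<delta>} \<union> {1 - \<delta><..}) (\<lambda>x. 0::real)" by simp
    then show "continuous_on ({..< -1 + \<delta>} \<union> {1 - \<delta><..}) (g i)" by (rule continuous_on_eq) (auto simp: g_def hh_def h0)
  qed auto
  define U where "U i x = integral {-1..x} (g i)" for i x
  \<comment> \<open>The range passes beyond 1 so that the parameters, like the seeds, are continuous
    at 1.\<close>
  have dU: "(U i has_real_derivative g i x) (at x)" if i: "i < k" and x: "x \<in> {-1<..<2}" for i x
  proof -
    have "(U i has_real_derivative g i x) (at x within {-1..2})"
      unfolding U_def by (rule integral_has_real_derivative) (use x in \<open>auto intro: continuous_on_subset[OF contg[OF i]]\<close>)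
    then show ?thesis using x by (simp add: at_within_Icc_at)
  qed
  have U0: "U i x = 0" if "x < -1 + \<delta>" for i x
  proof -
    have "U i x = integral {-1..x} (\<lambda>_. 0)"
      unfolding U_def by (rule integral_cong) (use that in \<open>auto simp: g_def hh_def h0\<close>)
    then show ?thesis by simp
  qed
  \<comment> \<open>Seeds may be singular at -1, but all parameters vanish near it, so the default 0
    continues Y smoothly. The term \<open>hh\<close> enters only at order k, where the
    differentiated parameters first contribute.\<close>
  define Y where "Y c x = (if x \<le> -1 then 0 else (\<Sum>i<k. J i c x * U i x) + (if c = k then hh x else 0))" for c x
  have Y0: "Y c x = 0" if "x < -1 + \<delta>" for c x
    using that by (auto simp: Y_def U0 hh_def h0)
  have contY: "continuous_on {-1..1} (Y c)" for c
  proof -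
    have "continuous_on ({..< -1 + \<delta>} \<union> {-1<..<2}) (Y c)"
    proof (rule continuous_on_open_Un)
      have "continuous_on {..< -1 + \<delta>} (\<lambda>x. 0::real)" by simp
      then show "continuous_on {..< -1 + \<delta>} (Y c)" by (rule continuous_on_eq) (auto simp: Y0)
      have "continuous_on {-1<..<2} (J i c)" if "i < k" for i
        by (rule continuous_at_imp_continuous_on) (use J_deriv[OF that] DERIV_isCont in fastforce)
      moreover have "continuous_on {-1<..<2} (U i)" if "i < k" for i
        by (rule continuous_at_imp_continuous_on) (use dU[OF that] DERIV_isCont in blast)
      ultimately have "continuous_on {-1<..<2} (\<lambda>x. (\<Sum>i<k. J i c x * U i x) + (if c = k then hh x else 0))"
        by (cases "c = k") (auto intro!: continuous_intros continuous_on_subset[OF conthh])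
      then show "continuous_on {-1<..<2} (Y c)" by (rule continuous_on_eq) (auto simp: Y_def)
    qed auto
    then show ?thesis by (rule continuous_on_subset) (use \<delta> in auto)
  qed
  have derY: "(Y c has_real_derivative Y (Suc c) x) (at x)" if c: "c < k" and x: "x \<in> {-1<..<1}" for c x
  proof -
    have "((\<lambda>x. \<Sum>i<k. J i c x * U i x) has_real_derivative (\<Sum>i<k. J i (Suc c) x * U i x + g i x * J i c x)) (at x)"
      by (intro DERIV_sum DERIV_mult J_deriv dU) (use x in auto)
    then have "(Y c has_real_derivative (\<Sum>i<k. J i (Suc c) x * U i x + g i x * J i c x)) (at x)"
      by (rule has_field_derivative_transform_within_open[where S="{-1<..<1}"]) (use x c in \<open>auto simp: Y_def\<close>)
    moreover have "(\<Sum>i<k. g i x * J i c x) = (if Suc c = k then hh x else 0)"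
    proof -
      have "(\<Sum>i<k. g i x * J i c x) = hh x * (\<Sum>i<k. V (k - 1) i x * J i c x)"
        using x by (simp add: g_def sum_distrib_left mult_ac)
      also have "\<dots> = (if Suc c = k then hh x else 0)"
        using VJ[of "k - 1" c x] c x by auto
      finally show ?thesis .
    qed
    ultimately show ?thesis using x by (simp add: Y_def sum.distrib)
  qed
  have TY: "(\<Sum>c\<le>k. poly (B c) x * Y c x) = h x" if x: "x \<in> {-1<..<1}" for x
  proof -
    have "(\<Sum>c\<le>k. poly (B c) x * Y c x) = (\<Sum>c\<le>k. (\<Sum>i<k. U i x * (poly (B c) x * J i c x)) + (if c = k then poly (B k) x * hh x else 0))"
      using x by (intro sum.cong) (auto simp: Y_def algebra_simps sum_distrib_left)
    also have "\<dots> = (\<Sum>c\<le>k. \<Sum>i<k. U i x * (poly (B c) x * J i c x)) + poly (B k) x * hh x"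
      by (simp add: sum.distrib)
    also have "(\<Sum>c\<le>k. \<Sum>i<k. U i x * (poly (B c) x * J i c x)) = (\<Sum>i<k. \<Sum>c\<le>k. U i x * (poly (B c) x * J i c x))"
      by (rule sum.swap)
    also have "\<dots> = (\<Sum>i<k. U i x * (\<Sum>c\<le>k. poly (B c) x * J i c x))" by (simp add: sum_distrib_left)
    also have "\<dots> = 0" by (simp add: kills[OF _ x])
    finally show ?thesis using B_top[OF x] x by (simp add: hh_def)
  qed
  have "\<exists>M. \<forall>c\<le>k. \<forall>x\<in>{-1..1}. \<bar>poly (B c) x\<bar> \<le> M"
  proof -
    have "\<exists>M. \<forall>x\<in>{-1..1}. \<bar>poly (B c) x\<bar> \<le> M" for c
    proof -
      have "compact ((\<lambda>x. poly (B c) x) ` {-1..1})"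
        by (intro compact_continuous_image continuous_intros compact_Icc)
      then show ?thesis by (auto dest!: compact_imp_bounded simp: bounded_iff)
    qed
    then obtain M where M: "\<And>c x. x \<in> {-1..1} \<Longrightarrow> \<bar>poly (B c) x\<bar> \<le> M c" by metis
    have "M c \<le> (\<Sum>c\<le>k. \<bar>M c\<bar>)" if "c \<le> k" for c
      using member_le_sum[of c "{..k}" "\<lambda>c. \<bar>M c\<bar>"] that by auto
    then show ?thesis using M by (meson order_trans)
  qed
  then obtain M where M: "\<And>c x. c \<le> k \<Longrightarrow> x \<in> {-1..1} \<Longrightarrow> \<bar>poly (B c) x\<bar> \<le> M" by blast
  have M0: "M \<ge> 0" using M[of 0 0] by auto
  \<comment> \<open>\<open>Suc k\<close> counts the terms, \<open>2 ^ k\<close> bounds the loss over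
    k integrations, and \<open>M + 1\<close> keeps the final estimate strict also if M = 0.\<close>
  define D where "D = real (Suc k) * ((M + 1) * 2 ^ k)"
  define \<eta> where "\<eta> = \<epsilon> / D"
  have D: "D > 0" using M0 unfolding D_def by (intro mult_pos_pos) auto
  then have \<eta>: "\<eta> > 0" using \<epsilon> by (simp add: \<eta>_def)
  have "\<exists>p. \<forall>c\<le>k. \<forall>x\<in>{-1..1}. \<bar>Y c x - poly (pder c p) x\<bar> \<le> 2 ^ (k - c) * \<eta>"
  proof (rule poly_approx_jet[where Y=Y and k=k and \<eta>=\<eta>])
    show "continuous_on {-1..1} (Y c)" for c by (rule contY)
    show "(Y c has_real_derivative Y (Suc c) x) (at x)" if "c < k" "x \<in> {-1<..<1}" for c x by (rule derY[OF that])
    show "Y c (-1) = 0" for c by (simp add: Y_def)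
  qed (rule \<eta>)
  then obtain p where p: "\<forall>c\<le>k. \<forall>x\<in>{-1..1}. \<bar>Y c x - poly (pder c p) x\<bar> \<le> 2 ^ (k - c) * \<eta>" by (rule exE)
  have "\<bar>h x - poly (\<Sum>c\<le>k. B c * pder c p) x\<bar> < \<epsilon>" if x: "x \<in> {-1<..<1}" for x
  proof -
    have x': "x \<in> {-1..1}" using x by auto
    have "h x - poly (\<Sum>c\<le>k. B c * pder c p) x = (\<Sum>c\<le>k. poly (B c) x * (Y c x - poly (pder c p) x))"
      unfolding TY[OF x, symmetric] by (simp add: poly_sum algebra_simps sum_subtractf)
    also have "\<bar>\<dots>\<bar> \<le> (\<Sum>c\<le>k. \<bar>poly (B c) x * (Y c x - poly (pder c p) x)\<bar>)" by (rule sum_abs)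
    also have "\<dots> \<le> (\<Sum>c\<le>k. M * (2 ^ k * \<eta>))"
    proof (rule sum_mono)
      fix c assume c: "c \<in> {..k}"
      have "\<bar>Y c x - poly (pder c p) x\<bar> \<le> 2 ^ (k - c) * \<eta>" using p c x' by simp
      also have "\<dots> \<le> 2 ^ k * \<eta>" using \<eta> by (intro mult_right_mono power_increasing) auto
      finally show "\<bar>poly (B c) x * (Y c x - poly (pder c p) x)\<bar> \<le> M * (2 ^ k * \<eta>)"
        using M[of c x] c x' M0 unfolding abs_mult by (intro mult_mono) auto
    qed
    also have "\<dots> = real (Suc k) * (M * (2 ^ k * \<eta>))" by (simp only: sum_constant card_atMost)
    also have "\<dots> < real (Suc k) * ((M + 1) * (2 ^ k * \<eta>))"
      using \<eta> by (intro mult_strict_left_mono mult_strict_right_mono) auto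
    also have "\<dots> = D * \<eta>" by (simp only: D_def mult.assoc)
    also have "\<dots> = \<epsilon>" using D by (simp add: \<eta>_def)
    finally show ?thesis .
  qed
  then show ?thesis by blast
qed

end

section \<open>Integrals and approximation in weighted spaces\<close>

text \<open>The Beta integral after the substitution t = (1+x)/2.\<close>

lemma set_integrable_jacobi_weight:
  assumes "a > -1" "b > (-1::real)"
  shows "set_integrable lborel {-1<..<1} (\<lambda>x. (1 - x) powr a * (1 + x) powr b)"
proof -
  define f where "f t = indicat_real {0..1} t *\<^sub>R (t powr (b + 1 - 1) * (1 - t) powr (a + 1 - 1))" for t
  have "integrable lborel f"
    using integrable_Beta[of "b + 1" "a + 1"] assms unfolding set_integrable_def f_def by simp
  then have "integrable lborel (\<lambda>x. 2 powr (a + b) * f (1/2 + 1/2 * x))"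
    by (intro integrable_mult_right lborel_integrable_real_affine) auto
  also have "(\<lambda>x. 2 powr (a + b) * f (1/2 + 1/2 * x)) = (\<lambda>x. indicat_real {-1..1} x *\<^sub>R ((1 - x) powr a * (1 + x) powr b))"
  proof
    fix x :: real
    show "2 powr (a + b) * f (1/2 + 1/2 * x) = indicat_real {-1..1} x *\<^sub>R ((1 - x) powr a * (1 + x) powr b)"
    proof (cases "x \<in> {-1..1}")
      case True
      have e: "1/2 + 1/2 * x = (1 + x) / 2" "1 - (1 + x) / 2 = (1 - x) / 2" by (simp_all add: field_simps)
      have "((1 + x) / 2) powr b = (1 + x) powr b / 2 powr b" "((1 - x) / 2) powr a = (1 - x) powr a / 2 powr a"
        using True by (simp_all add: powr_divide)
      then show ?thesis unfolding e(1) f_def e(2) using True by (simp add: powr_add)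
    qed (auto simp: f_def)
  qed
  finally have "set_integrable lborel {-1..1} (\<lambda>x. (1 - x) powr a * (1 + x) powr b)"
    by (simp add: set_integrable_def)
  then show ?thesis by (rule set_integrable_subset) auto
qed

lemma set_integrable_continuous_mult:
  fixes w \<phi> :: "real \<Rightarrow> real"
  assumes w: "set_integrable lborel {-1<..<1} w"
    and m: "\<phi> \<in> borel_measurable borel" and c: "continuous_on {-1..1} \<phi>"
  shows "set_integrable lborel {-1<..<1} (\<lambda>x. \<phi> x * w x)"
proof -
  have "compact (\<phi> ` {-1..1})" by (intro compact_continuous_image c compact_Icc)
  then have "\<exists>M. \<forall>x\<in>{-1..1}. \<bar>\<phi> x\<bar> \<le> M"
    by (auto dest!: compact_imp_bounded simp: bounded_iff)
  then obtain M where M: "\<And>x. x \<in> {-1..1} \<Longrightarrow> \<bar>\<phi> x\<bar> \<le> M" by blast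
  have Mi: "integrable lborel (\<lambda>x. M * (indicat_real {-1<..<1} x *\<^sub>R w x))"
    using w by (simp add: set_integrable_def)
  have mw: "(\<lambda>x. indicat_real {-1<..<1} x *\<^sub>R w x) \<in> borel_measurable lborel"
    using w unfolding set_integrable_def by (rule borel_measurable_integrable)
  have "integrable lborel (\<lambda>x. \<phi> x * (indicat_real {-1<..<1} x *\<^sub>R w x))"
  proof (rule Bochner_Integration.integrable_bound[OF Mi _ AE_I2])
    show "(\<lambda>x. \<phi> x * (indicat_real {-1<..<1} x *\<^sub>R w x)) \<in> borel_measurable lborel"
      using m mw by measurable
    fix x :: real
    show "norm (\<phi> x * (indicat_real {-1<..<1} x *\<^sub>R w x)) \<le> norm (M * (indicat_real {-1<..<1} x *\<^sub>R w x))"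
      using M[of x] by (auto simp: indicator_def abs_mult intro!: mult_right_mono)
  qed
  then show ?thesis by (simp add: set_integrable_def mult_ac)
qed

text \<open>The form in which boundary terms disappear: F need only be continuous at the endpoints,
  where its derivative may be unbounded.\<close>

lemma lbint_derivative_eq_0:
  fixes F f :: "real \<Rightarrow> real"
  assumes F: "continuous_on {-1..1} F" "F (-1) = 0" "F 1 = 0"
    and d: "\<And>x. x \<in> {-1<..<1} \<Longrightarrow> (F has_real_derivative f x) (at x)"
    and i: "set_integrable lborel {-1<..<1} f"
  shows "(LBINT x:{-1<..<1}. f x) = 0"
proof -
  have "(f has_integral F 1 - F (-1)) {-1..1}"
    by (rule fundamental_theorem_of_calculus_interior)
      (use F d in \<open>auto simp: has_real_derivative_iff_has_vector_derivative[symmetric]\<close>)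
  then have "integral {-1..1} f = 0" using F by (simp add: integral_unique)
  moreover have "integral {-1<..<1} f = integral {-1..1} f"
    using integral_open_interval_real[of "-1" 1 f] by simp
  ultimately show ?thesis using set_borel_integral_eq_integral(2)[OF i] by simp
qed

text \<open>A nonzero polynomial has finitely many zeros, so a vanishing integral would make (-1,1)
  a null set.\<close>

lemma lbint_poly_square_pos:
  fixes w :: "real \<Rightarrow> real"
  assumes q: "q \<noteq> 0" and w: "\<And>x. x \<in> {-1<..<1} \<Longrightarrow> w x > 0"
    and i: "set_integrable lborel {-1<..<1} (\<lambda>x. (poly q x)\<^sup>2 * w x)"
  shows "(LBINT x:{-1<..<1}. (poly q x)\<^sup>2 * w x) > 0"
proof -
  define g where "g x = indicat_real {-1<..<1} x *\<^sub>R ((poly q x)\<^sup>2 * w x)" for x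
  have ig: "integrable lborel g" using i unfolding set_integrable_def g_def .
  have g0: "g x \<ge> 0" for x using less_imp_le[OF w[of x]] by (auto simp: g_def indicator_def)
  have "integral\<^sup>L lborel g \<noteq> 0"
  proof
    assume "integral\<^sup>L lborel g = 0"
    then have "AE x in lborel. g x = 0"
      using integral_nonneg_eq_0_iff_AE[OF ig] g0 by auto
    then have "AE x in lborel. x \<notin> {-1<..<1} - {x. poly q x = 0}"
      by eventually_elim (use w in \<open>force simp: g_def indicator_def\<close>)
    moreover have fin: "finite {x. poly q x = 0}" using q by (rule poly_roots_finite)
    moreover have s: "{-1<..<1} - {x. poly q x = 0} \<in> sets lborel"
      using finite_imp_closed[OF fin] by (auto intro!: sets.Diff borel_closed)
    ultimately have "{-1<..<1} - {x. poly q x = 0} \<in> null_sets lborel"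
      using AE_iff_null_sets by blast
    moreover have "{x. poly q x = 0} \<in> null_sets lborel" using fin by (rule finite_imp_null_set_lborel)
    ultimately have "({-1<..<1} - {x. poly q x = 0}) \<union> {x. poly q x = 0} \<in> null_sets lborel" by blast
    then have "{-1<..<1::real} \<in> null_sets lborel" by (rule null_sets_subset) auto
    then show False by (auto simp: null_sets_def)
  qed
  moreover have "integral\<^sup>L lborel g \<ge> 0" using g0 by simp
  ultimately show ?thesis unfolding set_lebesgue_integral_def g_def[symmetric] by simp
qed

section \<open>Reduction to continuous functions of compact support\<close>

lemma tendsto_zero_less:
  assumes "X \<longlonglongrightarrow> (0::real)" "0 < e"
  shows "\<exists>n. X n < e"
proof -
  have "\<forall>\<^sub>F n in sequentially. X n < e" using order_tendstoD(2)[OF assms] .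
  then show ?thesis by (auto simp: eventually_sequentially)
qed

lemma dominated_to_zero:
  fixes s :: "nat \<Rightarrow> real \<Rightarrow> real"
  assumes "\<And>n. s n \<in> borel_measurable lborel" "integrable lborel b"
    and "AE x in lborel. (\<lambda>n. s n x) \<longlonglongrightarrow> 0" "\<And>n x. \<bar>s n x\<bar> \<le> b x"
  shows "(\<lambda>n. integral\<^sup>L lborel (s n)) \<longlonglongrightarrow> 0" "integrable lborel (s n)"
proof -
  have "(\<lambda>n. integral\<^sup>L lborel (s n)) \<longlonglongrightarrow> integral\<^sup>L lborel (\<lambda>_::real. 0::real)"
    by (intro integral_dominated_convergence[OF _ _ assms(2)]) (use assms in auto)
  then show "(\<lambda>n. integral\<^sup>L lborel (s n)) \<longlonglongrightarrow> 0" by simp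
  show "integrable lborel (s n)"
    by (rule Bochner_Integration.integrable_bound[OF assms(2)]) (use assms(1,4) in \<open>auto intro!: AE_I2 intro: order_trans[OF _ abs_ge_self]\<close>)
qed

text \<open>The characterization of measurability by limits of continuous functions lives on the
  completed measure; its exceptional null set is carried back to \<open>lborel\<close>.\<close>

lemma borel_ae_limit_continuous:
  fixes f :: "real \<Rightarrow> real"
  assumes "f \<in> borel_measurable lborel"
  obtains g where "\<And>n. continuous_on UNIV (g n)" "AE x in lborel. (\<lambda>n. g n x) \<longlonglongrightarrow> f x"
proof -
  have "f \<in> borel_measurable lebesgue" using assms by (simp add: measurable_completion)
  then have "f measurable_on UNIV" by (simp add: lebesgue_measurable_imp_measurable_on_real)
  then obtain N g where N: "negligible N" and g: "\<And>n. continuous_on UNIV (g n)"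
    and lim: "\<And>x. x \<notin> N \<Longrightarrow> (\<lambda>n. g n x) \<longlonglongrightarrow> f x"
    unfolding measurable_on_def by auto
  have "N \<in> null_sets lebesgue" using N by (simp add: negligible_iff_null_sets)
  then have "AE x in lebesgue. x \<notin> N" by (rule AE_not_in)
  then have "AE x in lborel. x \<notin> N" by (simp add: AE_completion_iff)
  then have "AE x in lborel. (\<lambda>n. g n x) \<longlonglongrightarrow> f x" by eventually_elim (rule lim)
  then show ?thesis using g that by blast
qed

text \<open>Dominated convergence is used twice. Truncating f in height and support is dominated by
  \<open>f^2 W\<close>; after that the continuous approximants, truncated in the same way, are
  dominated by a constant multiple of the integrable weight.\<close>

lemma approx_compact_support:
  fixes f w :: "real \<Rightarrow> real"
  assumes f: "f \<in> borel_measurable lborel"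
    and wm: "w \<in> borel_measurable lborel" and w0: "\<And>x. x \<in> {-1<..<1} \<Longrightarrow> w x \<ge> 0"
    and wi: "set_integrable lborel {-1<..<1} w"
    and fi: "set_integrable lborel {-1<..<1} (\<lambda>x. (f x)\<^sup>2 * w x)" and \<epsilon>: "\<epsilon> > 0"
  shows "\<exists>h \<delta>. continuous_on UNIV h \<and> 0 < \<delta> \<and> \<delta> < 1 \<and> (\<forall>x. \<bar>x\<bar> > 1 - \<delta> \<longrightarrow> h x = 0)
     \<and> set_integrable lborel {-1<..<1} (\<lambda>x. (f x - h x)\<^sup>2 * w x)
     \<and> (LBINT x:{-1<..<1}. (f x - h x)\<^sup>2 * w x) < \<epsilon>"
proof -
  define W where "W x = indicat_real {-1<..<1} x * w x" for x
  have W0: "W x \<ge> 0" for x using w0 by (auto simp: W_def indicator_def)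
  have Wm [measurable]: "W \<in> borel_measurable lborel" unfolding W_def using wm by measurable
  have Wi: "integrable lborel W" using wi by (simp add: set_integrable_def W_def[abs_def])
  have fWi: "integrable lborel (\<lambda>x. (f x)\<^sup>2 * W x)"
    using fi by (simp add: set_integrable_def W_def mult_ac)
  \<comment> \<open>A trapezoid: 0 where 1 - |x| <= 1/(m+2) and 1 where 1 - |x| >= 2/(m+2). With m +
    2 the margin 1/(m+2) is below 1 also for m = 0.\<close>
  define ct where "ct m x = max 0 (min 1 (real (m + 2) * (1 - \<bar>x\<bar>) - 1))" for m :: nat and x :: real
  define cl where "cl m y = max (- real m) (min (real m) y)" for m :: nat and y :: real
  have ctc: "continuous_on UNIV (ct m)" for m unfolding ct_def by (intro continuous_intros)
  have ct01: "0 \<le> ct m x" "ct m x \<le> 1" for m x by (auto simp: ct_def)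
  have [measurable]: "ct m \<in> borel_measurable borel" for m by (rule borel_measurable_continuous_onI[OF ctc])
  have clc: "continuous_on UNIV (cl m)" for m unfolding cl_def by (intro continuous_intros)
  have [measurable]: "cl m \<in> borel_measurable borel" for m by (rule borel_measurable_continuous_onI[OF clc])
  note f[measurable]
  define F where "F m x = cl m (f x) * ct m x" for m x
  have [measurable]: "F m \<in> borel_measurable lborel" for m unfolding F_def by measurable
  \<comment> \<open>Clamping and multiplying by a factor in [0,1] both move a value toward 0 without
    crossing it.\<close>
  have fF: "(f x - F m x)\<^sup>2 \<le> (f x)\<^sup>2" for m x
  proof -
    have "\<bar>y - cl m y * t\<bar> \<le> \<bar>y\<bar>" if "0 \<le> t" "t \<le> 1" for y t
    proof (cases "y \<ge> 0")
      case True
      then have "0 \<le> cl m y" "cl m y \<le> y" by (auto simp: cl_def)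
      then have "0 \<le> cl m y * t" "cl m y * t \<le> y" using that by (auto intro: order_trans[OF mult_left_le])
      then show ?thesis using True by auto
    next
      case False
      then have "cl m y \<le> 0" "y \<le> cl m y" by (auto simp: cl_def)
      then have "0 \<le> - cl m y * t" "- cl m y * t \<le> - cl m y" using that
        using mult_left_mono_neg[of t 1 "cl m y"] by (auto simp: mult_nonpos_nonneg)
      then have "0 \<le> - cl m y * t" "- cl m y * t \<le> - y" using \<open>y \<le> cl m y\<close> by auto
      then show ?thesis using False by auto
    qed
    from this[OF ct01, of "f x" m x] show ?thesis unfolding F_def by (simp add: abs_le_square_iff)
  qed
  have Flim: "(\<lambda>m. (f x - F m x)\<^sup>2 * W x) \<longlonglongrightarrow> 0" for x
  proof (cases "x \<in> {-1<..<1}")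
    case True
    then have x: "1 - \<bar>x\<bar> > 0" by auto
    obtain m0 where m0: "real m0 > max \<bar>f x\<bar> (2 / (1 - \<bar>x\<bar>))" using reals_Archimedean2 by blast
    have "F m x = f x" if m: "m \<ge> m0" for m
    proof -
      have "real m \<ge> \<bar>f x\<bar>" "real m \<ge> 2 / (1 - \<bar>x\<bar>)" using m0 m by auto
      then have "cl m (f x) = f x" "real (m + 2) * (1 - \<bar>x\<bar>) \<ge> 2"
        using x by (auto simp: cl_def field_simps)
      then show ?thesis by (simp add: F_def ct_def)
    qed
    then have "\<forall>\<^sub>F m in sequentially. (f x - F m x)\<^sup>2 * W x = 0"
      by (intro eventually_sequentiallyI[of m0]) simp
    then show ?thesis by (rule tendsto_eventually)
  qed (simp add: W_def)
  have "(\<lambda>m. integral\<^sup>L lborel (\<lambda>x. (f x - F m x)\<^sup>2 * W x)) \<longlonglongrightarrow> 0"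
    and F_int: "integrable lborel (\<lambda>x. (f x - F m x)\<^sup>2 * W x)" for m
    by (rule dominated_to_zero[OF _ fWi, where s="\<lambda>m x. (f x - F m x)\<^sup>2 * W x"];
        use Flim fF W0 in \<open>auto simp: abs_mult intro!: mult_right_mono\<close>)+
  \<comment> \<open>Each of the two errors enters the final bound with a factor 2, from (u+v)^2 <=
    2u^2 + 2v^2.\<close>
  then obtain m where m: "integral\<^sup>L lborel (\<lambda>x. (f x - F m x)\<^sup>2 * W x) < \<epsilon> / 4"
    using tendsto_zero_less[of _ "\<epsilon> / 4"] \<epsilon> by fastforce
  obtain g where g: "\<And>n. continuous_on UNIV (g n)" "AE x in lborel. (\<lambda>n. g n x) \<longlonglongrightarrow> f x"
    using borel_ae_limit_continuous[OF f] by blast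
  define H where "H n x = cl m (g n x) * ct m x" for n x
  have Hc: "continuous_on UNIV (H n)" for n unfolding H_def
    by (intro continuous_intros ctc continuous_on_compose2[OF clc g(1)]) auto
  have [measurable]: "H n \<in> borel_measurable borel" for n by (rule borel_measurable_continuous_onI[OF Hc])
  have FH: "(F m x - H n x)\<^sup>2 \<le> (2 * real m)\<^sup>2" for n x
  proof -
    have "\<bar>cl m y * t\<bar> \<le> real m" if "0 \<le> t" "t \<le> 1" for y t
      using mult_mono[of "\<bar>cl m y\<bar>" "real m" t 1] that by (auto simp: cl_def abs_mult)
    then have "\<bar>F m x\<bar> \<le> real m" "\<bar>H n x\<bar> \<le> real m" using ct01 unfolding F_def H_def by auto
    then have "\<bar>F m x - H n x\<bar> \<le> \<bar>2 * real m\<bar>" by auto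
    then show ?thesis by (simp only: abs_le_square_iff)
  qed
  have Hlim: "AE x in lborel. (\<lambda>n. (F m x - H n x)\<^sup>2 * W x) \<longlonglongrightarrow> 0"
    using g(2)
  proof eventually_elim
    fix x assume "(\<lambda>n. g n x) \<longlonglongrightarrow> f x"
    then have "(\<lambda>n. cl m (g n x)) \<longlonglongrightarrow> cl m (f x)"
      unfolding cl_def by (intro tendsto_intros)
    then have "(\<lambda>n. (F m x - H n x)\<^sup>2 * W x) \<longlonglongrightarrow> (F m x - cl m (f x) * ct m x)\<^sup>2 * W x"
      unfolding H_def by (intro tendsto_intros)
    then show "(\<lambda>n. (F m x - H n x)\<^sup>2 * W x) \<longlonglongrightarrow> 0" by (simp add: F_def)
  qed
  have bi: "integrable lborel (\<lambda>x. (2 * real m)\<^sup>2 * W x)" using Wi by simp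
  have "(\<lambda>n. integral\<^sup>L lborel (\<lambda>x. (F m x - H n x)\<^sup>2 * W x)) \<longlonglongrightarrow> 0"
    and H_int: "integrable lborel (\<lambda>x. (F m x - H n x)\<^sup>2 * W x)" for n
    by (rule dominated_to_zero[OF _ bi, where s="\<lambda>n x. (F m x - H n x)\<^sup>2 * W x"];
        use Hlim FH W0 in \<open>auto simp: abs_mult intro!: mult_right_mono\<close>)+
  then obtain n where n: "integral\<^sup>L lborel (\<lambda>x. (F m x - H n x)\<^sup>2 * W x) < \<epsilon> / 4"
    using tendsto_zero_less[of _ "\<epsilon> / 4"] \<epsilon> by fastforce
  have bound: "(f x - H n x)\<^sup>2 * W x \<le> 2 * ((f x - F m x)\<^sup>2 * W x) + 2 * ((F m x - H n x)\<^sup>2 * W x)" for x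
  proof -
    have "(f x - H n x)\<^sup>2 \<le> 2 * (f x - F m x)\<^sup>2 + 2 * (F m x - H n x)\<^sup>2"
      using sum_squares_bound[of "f x - F m x" "F m x - H n x"] by (simp add: power2_eq_square algebra_simps)
    then have "(f x - H n x)\<^sup>2 * W x \<le> (2 * (f x - F m x)\<^sup>2 + 2 * (F m x - H n x)\<^sup>2) * W x"
      using W0 by (rule mult_right_mono)
    then show ?thesis by (simp add: algebra_simps)
  qed
  have bi2: "integrable lborel (\<lambda>x. 2 * ((f x - F m x)\<^sup>2 * W x) + 2 * ((F m x - H n x)\<^sup>2 * W x))"
    using F_int H_int by simp
  have fH_int: "integrable lborel (\<lambda>x. (f x - H n x)\<^sup>2 * W x)"
    by (rule Bochner_Integration.integrable_bound[OF bi2]) (use bound W0 in \<open>auto intro!: AE_I2 order_trans[OF bound abs_ge_self]\<close>)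
  have "integral\<^sup>L lborel (\<lambda>x. (f x - H n x)\<^sup>2 * W x) \<le> integral\<^sup>L lborel (\<lambda>x. 2 * ((f x - F m x)\<^sup>2 * W x) + 2 * ((F m x - H n x)\<^sup>2 * W x))"
    by (rule integral_mono[OF fH_int bi2 bound])
  also have "\<dots> < \<epsilon>" using F_int H_int m n by simp
  finally have "integral\<^sup>L lborel (\<lambda>x. (f x - H n x)\<^sup>2 * W x) < \<epsilon>" .
  moreover have "H n x = 0" if "\<bar>x\<bar> > 1 - 1 / real (m + 2)" for x
  proof -
    have "real (m + 2) * (1 - \<bar>x\<bar>) < real (m + 2) * (1 / real (m + 2))"
      using that by (intro mult_strict_left_mono) auto
    then show ?thesis by (simp add: H_def ct_def)
  qed
  ultimately show ?thesis using Hc fH_int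
    by (intro exI[of _ "H n"] exI[of _ "1 / real (m + 2)"])
      (auto simp: set_integrable_def set_lebesgue_integral_def W_def mult_ac)
qed

text \<open>For a weight of finite total mass uniform closeness implies closeness in the weighted
  square norm, so the class \<open>P\<close> needs to be tested only against compactly supported
  continuous functions.\<close>

lemma dense_if_uniformly_dense:
  fixes f w :: "real \<Rightarrow> real" and P :: "real poly \<Rightarrow> bool"
  assumes f: "f \<in> borel_measurable lborel"
    and wm: "w \<in> borel_measurable lborel" and w0: "\<And>x. x \<in> {-1<..<1} \<Longrightarrow> w x \<ge> 0"
    and wi: "set_integrable lborel {-1<..<1} w"
    and fi: "set_integrable lborel {-1<..<1} (\<lambda>x. (f x)\<^sup>2 * w x)" and \<epsilon>: "\<epsilon> > 0"
    and approx: "\<And>h \<delta> \<eta>. continuous_on UNIV h \<Longrightarrow> 0 < \<delta> \<Longrightarrow> \<delta> < 1 \<Longrightarrow> (\<And>x. \<bar>x\<bar> > 1 - \<delta> \<Longrightarrow> h x = 0) \<Longrightarrow> (0::real) < \<eta>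
       \<Longrightarrow> \<exists>q. P q \<and> (\<forall>x\<in>{-1<..<1}. \<bar>h x - poly q x\<bar> < \<eta>)"
  shows "\<exists>q. P q \<and> (LBINT x:{-1<..<1}. (f x - poly q x)\<^sup>2 * w x) < \<epsilon>"
proof -
  obtain h \<delta> where h: "continuous_on UNIV h" "0 < \<delta>" "\<delta> < 1" "\<And>x. \<bar>x\<bar> > 1 - \<delta> \<Longrightarrow> h x = 0"
     and hi: "set_integrable lborel {-1<..<1} (\<lambda>x. (f x - h x)\<^sup>2 * w x)"
     and hl: "(LBINT x:{-1<..<1}. (f x - h x)\<^sup>2 * w x) < \<epsilon> / 4"
    using approx_compact_support[OF f wm w0 wi fi, of "\<epsilon>/4"] \<epsilon> by auto
  define c where "c = (LBINT x:{-1<..<1}. w x)"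
  have c0: "c \<ge> 0" unfolding c_def set_lebesgue_integral_def
    using w0 by (intro Bochner_Integration.integral_nonneg) (auto simp: indicator_def)
  \<comment> \<open>\<open>c + 1\<close> keeps the quotient defined when the total mass c is 0 and
    still bounds \<open>\<eta>\<^sup>2 * c\<close> by \<epsilon>/4.\<close>
  define \<eta> where "\<eta> = sqrt (\<epsilon> / (4 * (c + 1)))"
  have \<eta>: "\<eta> > 0" using \<epsilon> c0 by (simp add: \<eta>_def)
  have \<eta>2: "\<eta>\<^sup>2 = \<epsilon> / (4 * (c + 1))" using \<epsilon> c0 by (simp add: \<eta>_def)
  obtain q where q: "P q" "\<And>x. x \<in> {-1<..<1} \<Longrightarrow> \<bar>h x - poly q x\<bar> < \<eta>"
    using approx[OF h \<eta>] by blast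
  define W where "W x = indicat_real {-1<..<1} x * w x" for x
  have W0: "W x \<ge> 0" for x using w0 by (auto simp: W_def indicator_def)
  have Wm [measurable]: "W \<in> borel_measurable lborel" unfolding W_def using wm by measurable
  note f[measurable]
  have [measurable]: "poly q \<in> borel_measurable borel"
    by (intro borel_measurable_continuous_onI continuous_intros)
  have bound: "(f x - poly q x)\<^sup>2 * W x \<le> 2 * ((f x - h x)\<^sup>2 * W x) + 2 * (\<eta>\<^sup>2 * W x)" for x
  proof (cases "x \<in> {-1<..<1}")
    case True
    have "\<bar>h x - poly q x\<bar> \<le> \<bar>\<eta>\<bar>" using q(2)[OF True] by simp
    then have "(h x - poly q x)\<^sup>2 \<le> \<eta>\<^sup>2" by (simp only: abs_le_square_iff)
    moreover have "(f x - poly q x)\<^sup>2 \<le> 2 * (f x - h x)\<^sup>2 + 2 * (h x - poly q x)\<^sup>2"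
      using sum_squares_bound[of "f x - h x" "h x - poly q x"] by (simp add: power2_eq_square algebra_simps)
    ultimately have "(f x - poly q x)\<^sup>2 \<le> 2 * (f x - h x)\<^sup>2 + 2 * \<eta>\<^sup>2" by linarith
    then have "(f x - poly q x)\<^sup>2 * W x \<le> (2 * (f x - h x)\<^sup>2 + 2 * \<eta>\<^sup>2) * W x"
      using W0 by (rule mult_right_mono)
    then show ?thesis by (simp add: algebra_simps)
  qed (simp add: W_def)
  have i1: "integrable lborel (\<lambda>x. (f x - h x)\<^sup>2 * W x)"
    using hi by (simp add: set_integrable_def W_def mult_ac)
  have i2: "integrable lborel W"
    using wi by (simp add: set_integrable_def W_def[abs_def])
  have bi: "integrable lborel (\<lambda>x. 2 * ((f x - h x)\<^sup>2 * W x) + 2 * (\<eta>\<^sup>2 * W x))"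
    using i1 i2 by simp
  have fq: "integrable lborel (\<lambda>x. (f x - poly q x)\<^sup>2 * W x)"
    by (rule Bochner_Integration.integrable_bound[OF bi]) (use bound W0 in \<open>auto intro!: AE_I2 order_trans[OF bound abs_ge_self]\<close>)
  have "integral\<^sup>L lborel (\<lambda>x. (f x - poly q x)\<^sup>2 * W x) \<le> integral\<^sup>L lborel (\<lambda>x. 2 * ((f x - h x)\<^sup>2 * W x) + 2 * (\<eta>\<^sup>2 * W x))"
    by (rule integral_mono[OF fq bi bound])
  also have "\<dots> = 2 * (LBINT x:{-1<..<1}. (f x - h x)\<^sup>2 * w x) + 2 * \<eta>\<^sup>2 * c"
  proof -
    have "(LBINT x:{-1<..<1}. (f x - h x)\<^sup>2 * w x) = integral\<^sup>L lborel (\<lambda>x. (f x - h x)\<^sup>2 * W x)"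
      "c = integral\<^sup>L lborel W"
      by (simp_all add: c_def set_lebesgue_integral_def W_def[abs_def] mult_ac)
    then show ?thesis using i1 i2 by simp
  qed
  also have "\<dots> < \<epsilon>"
  proof -
    have "\<eta>\<^sup>2 * c \<le> \<epsilon> / 4" using c0 \<epsilon> unfolding \<eta>2 by (simp add: field_simps)
    then show ?thesis using hl by linarith
  qed
  finally show ?thesis using q(1)
    by (intro exI[of _ q]) (simp add: set_lebesgue_integral_def W_def mult_ac)
qed

section \<open>Exceptional Jacobi polynomials\<close>

lemma jet_poly: "jet (\<lambda>c. poly (pder c p))"
  unfolding jet_def pder_Suc by (intro allI ballI poly_DERIV)

lemma ejet_jacobi: "ejet \<alpha> \<beta> (- real n * (real n + \<alpha> + \<beta> + 1)) (\<lambda>c. poly (pder c (jacobi \<alpha> \<beta> n)))"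
  unfolding ejet_def using jet_poly jacobi_ode[of _ \<alpha> \<beta> n] by (auto simp: pder_def numeral_2_eq_2)

text \<open>Each step is the raising formula at (\<alpha> + c, -\<beta> - c), whose factors
  accumulate to the Pochhammer symbol. This identifies the F2 rows as derivatives of one function,
  like the F1 rows.\<close>

lemma shifted_row_jacobi: "shifted_row \<beta> c (jacobi \<alpha> (-\<beta>) n) = Polynomial.smult (pochhammer (\<beta> - real n) c) (jacobi (\<alpha> + real c) (- \<beta> - real c) n)"
proof (induction c)
  case (Suc c)
  define P where "P = jacobi (\<alpha> + real c) (- \<beta> - real c) n"
  define Q where "Q = jacobi (\<alpha> + real (Suc c)) (- \<beta> - real (Suc c)) n"
  have "[:1,1:] * pderiv P + Polynomial.smult (- \<beta> - real c) P = Polynomial.smult (real n + (- \<beta> - real c)) Q"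
    using jacobi_raise_right[of "\<alpha> + real c" "- \<beta> - real c" n] by (simp add: P_def Q_def algebra_simps)
  then have "Polynomial.smult (\<beta> + real c) P - [:1,1:] * pderiv P = Polynomial.smult (\<beta> - real n + real c) Q"
  proof -
    assume h: "[:1,1:] * pderiv P + Polynomial.smult (- \<beta> - real c) P = Polynomial.smult (real n + (- \<beta> - real c)) Q"
    have "Polynomial.smult (- \<beta> - real c) P = - Polynomial.smult (\<beta> + real c) P"
      by (simp only: smult_minus_left[symmetric]) simp
    then have "Polynomial.smult (\<beta> + real c) P - [:1,1:] * pderiv P = - ([:1,1:] * pderiv P + Polynomial.smult (- \<beta> - real c) P)"
      by simp
    also have "\<dots> = - Polynomial.smult (real n + (- \<beta> - real c)) Q" using h by simp
    also have "\<dots> = Polynomial.smult (\<beta> - real n + real c) Q"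
      by (simp only: smult_minus_left[symmetric]) (simp add: algebra_simps)
    finally show ?thesis .
  qed
  then have "Polynomial.smult (pochhammer (\<beta> - real n) c) (Polynomial.smult (\<beta> + real c) P - [:1,1:] * pderiv P)
     = Polynomial.smult (pochhammer (\<beta> - real n) (Suc c)) Q"
    by (simp add: pochhammer_Suc)
  then show ?case
    unfolding shifted_row.simps Suc P_def[symmetric] Q_def[symmetric] by (simp add: pderiv_smult smult_diff_right mult.commute)
qed simp

text \<open>The derivatives of \<open>(1+x) powr (-\<beta>)\<close> times q, the form of a seed from
  F2.\<close>

definition shifted_jet :: "real \<Rightarrow> real poly \<Rightarrow> nat \<Rightarrow> real \<Rightarrow> real" where
  "shifted_jet \<beta> q c x = (-1) ^ c * ((1 + x) powr (- \<beta> - real c) * poly (shifted_row \<beta> c q) x)"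

lemma shifted_jet_deriv:
  assumes "-1 < x"
  shows "(shifted_jet \<beta> q c has_real_derivative shifted_jet \<beta> q (Suc c) x) (at x)"
proof -
  define P where "P = (1 + x) powr (- \<beta> - real (Suc c))"
  have P: "(1 + x) powr (- \<beta> - real c) = P * (1 + x)"
    using assms powr_add[of "1 + x" "- \<beta> - real (Suc c)" 1] by (simp add: P_def)
  have "((\<lambda>x. (1 + x) powr (- \<beta> - real c)) has_real_derivative (- \<beta> - real c) * P) (at x)"
    unfolding P_def using assms by (auto intro!: derivative_eq_intros simp: algebra_simps)
  then have "((\<lambda>x. (-1) ^ c * ((1 + x) powr (- \<beta> - real c) * poly (shifted_row \<beta> c q) x)) has_real_derivative
     (-1) ^ c * ((- \<beta> - real c) * P * poly (shifted_row \<beta> c q) x + poly (pderiv (shifted_row \<beta> c q)) x * (1 + x) powr (- \<beta> - real c))) (at x)"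
    by (intro DERIV_cmult DERIV_mult poly_DERIV)
  moreover have "(-1) ^ c * ((- \<beta> - real c) * P * poly (shifted_row \<beta> c q) x + poly (pderiv (shifted_row \<beta> c q)) x * (1 + x) powr (- \<beta> - real c))
    = shifted_jet \<beta> q (Suc c) x"
    unfolding P shifted_jet_def P_def[symmetric] by (simp add: algebra_simps)
  ultimately show ?thesis unfolding shifted_jet_def[abs_def] by simp
qed

text \<open>Conjugation by \<open>(1+x) powr (-\<beta>)\<close> exchanges \<beta> and -\<beta> in
  the Jacobi operator up to a constant, which moves the eigenvalue -n(n + \<alpha> - \<beta> + 1) by
  \<beta>(\<alpha> + 1).\<close>

lemma shifted_jet_ode:
  fixes \<alpha> \<beta> x :: real and n :: nat
  assumes x: "x \<in> {-1<..<1}"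
  defines "Y \<equiv> shifted_jet \<beta> (jacobi \<alpha> (- \<beta>) n)"
  shows "(1 - x\<^sup>2) * Y 2 x + (\<beta> - \<alpha> - (\<alpha> + \<beta> + 2) * x) * Y 1 x = - (real n - \<beta>) * (real n + \<alpha> + 1) * Y 0 x"
proof -
  define q where "q = jacobi \<alpha> (- \<beta>) n"
  \<comment> \<open>All real powers are expressed by the lowest one, which leaves a polynomial
    identity.\<close>
  define P where "P = (1 + x) powr (- \<beta> - 2)"
  have P1: "(1 + x) powr (- \<beta> - 1) = P * (1 + x)"
  proof -
    have "(1 + x) powr (- \<beta> - 1) = (1 + x) powr ((- \<beta> - 2) + 1)"
      by (rule arg_cong[where f = "\<lambda>y. (1 + x) powr y"]) simp
    also have "\<dots> = P * (1 + x)" using x by (simp only: powr_add P_def) simp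
    finally show ?thesis .
  qed
  have P0: "(1 + x) powr (- \<beta>) = P * (1 + x) * (1 + x)"
  proof -
    have "(1 + x) powr (- \<beta>) = (1 + x) powr ((- \<beta> - 1) + 1)"
      by (rule arg_cong[where f = "\<lambda>y. (1 + x) powr y"]) simp
    also have "\<dots> = P * (1 + x) * (1 + x)" using x by (simp only: powr_add P1) simp
    finally show ?thesis .
  qed
  define q0 q1 q2 where "q0 = poly q x" and "q1 = poly (pderiv q) x" and "q2 = poly (pderiv (pderiv q)) x"
  have ode: "(1 - x^2) * q2 + (- \<beta> - \<alpha> - (\<alpha> - \<beta> + 2) * x) * q1 + real n * (real n + \<alpha> - \<beta> + 1) * q0 = 0"
    using jacobi_ode[of x \<alpha> "- \<beta>" n] by (simp add: q0_def q1_def q2_def q_def)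
  have Y0: "Y 0 x = P * (1 + x) * (1 + x) * q0" by (simp add: Y_def shifted_jet_def q_def[symmetric] P0 q0_def)
  have Y1: "Y 1 x = - (P * (1 + x)) * (\<beta> * q0 - (1 + x) * q1)"
    by (simp add: Y_def shifted_jet_def q_def[symmetric] P1 q0_def q1_def algebra_simps)
  have "shifted_row \<beta> 2 q = Polynomial.smult (\<beta> + 1) (Polynomial.smult \<beta> q - [:1,1:] * pderiv q) - [:1,1:] * pderiv (Polynomial.smult \<beta> q - [:1,1:] * pderiv q)"
    by (simp add: numeral_2_eq_2)
  also have "\<dots> = Polynomial.smult (\<beta> + 1) (Polynomial.smult \<beta> q - [:1,1:] * pderiv q)
      - [:1,1:] * (Polynomial.smult \<beta> (pderiv q) - (pderiv q + [:1,1:] * pderiv (pderiv q)))"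
  proof -
    have "pderiv ([:1,1:] * pderiv q) = pderiv q + [:1,1:] * pderiv (pderiv q)"
      by (subst pderiv_mult) (simp add: pderiv_pCons)
    then show ?thesis by (simp only: pderiv_diff pderiv_smult)
  qed
  also have "poly \<dots> x = (\<beta> + 1) * (\<beta> * q0 - (1 + x) * q1) - (1 + x) * (\<beta> * q1 - (q1 + (1 + x) * q2))"
    by (simp add: q0_def q1_def q2_def algebra_simps)
  finally have o2: "poly (shifted_row \<beta> 2 q) x = (\<beta> + 1) * (\<beta> * q0 - (1 + x) * q1) - (1 + x) * (\<beta> * q1 - (q1 + (1 + x) * q2))" .
  have Y2: "Y 2 x = P * ((\<beta> + 1) * (\<beta> * q0 - (1 + x) * q1) - (1 + x) * (\<beta> * q1 - (q1 + (1 + x) * q2)))"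
    unfolding o2[symmetric] by (simp add: Y_def shifted_jet_def q_def[symmetric] P_def)
  have "(1 - x\<^sup>2) * Y 2 x + (\<beta> - \<alpha> - (\<alpha> + \<beta> + 2) * x) * Y 1 x - (- (real n - \<beta>) * (real n + \<alpha> + 1) * Y 0 x)
     = P * (1 + x)^2 * ((1 - x^2) * q2 + (- \<beta> - \<alpha> - (\<alpha> - \<beta> + 2) * x) * q1 + real n * (real n + \<alpha> - \<beta> + 1) * q0)"
    unfolding Y0 Y1 Y2 by (simp add: algebra_simps power2_eq_square)
  then show ?thesis unfolding ode by simp
qed

lemma poly_basis:
  fixes P :: "nat \<Rightarrow> real poly"
  assumes "\<And>a. degree (P a) = a" "\<And>a. P a \<noteq> 0" "degree p \<le> N"
  shows "\<exists>d. p = (\<Sum>a\<le>N. Polynomial.smult (d a) (P a))"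
  using assms(3)
proof (induction N arbitrary: p)
  case 0
  obtain a b where ab: "p = [:a:]" "P 0 = [:b:]" using 0 assms(1)[of 0] degree_0_id by (metis le_zero_eq)
  then have "b \<noteq> 0" using assms(2)[of 0] by auto
  then show ?case using ab by (intro exI[of _ "\<lambda>_. a / b"]) simp
next
  case (Suc N)
  define c where "c = coeff p (Suc N) / coeff (P (Suc N)) (Suc N)"
  have nz: "coeff (P (Suc N)) (Suc N) \<noteq> 0" using assms(1)[of "Suc N"] assms(2)[of "Suc N"] by (metis leading_coeff_0_iff)
  define r where "r = p - Polynomial.smult c (P (Suc N))"
  have "coeff r (Suc N) = 0" using nz by (simp add: r_def c_def)
  moreover have "degree r \<le> Suc N" unfolding r_def 
    using Suc.prems assms(1)[of "Suc N"] by (intro degree_diff_le) (auto intro: order_trans[OF degree_smult_le])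
  ultimately have "degree r \<le> N"
    by (metis coeff_0 degree_0 le_SucE leading_coeff_0_iff zero_le)
  then obtain d where d: "r = (\<Sum>a\<le>N. Polynomial.smult (d a) (P a))" using Suc.IH by blast
  have "p = r + Polynomial.smult c (P (Suc N))" by (simp add: r_def)
  also have "\<dots> = (\<Sum>a\<le>Suc N. Polynomial.smult ((d(Suc N := c)) a) (P a))"
    unfolding d by simp
  finally show ?case by blast
qed

section \<open>Seeds and operator of the given pair\<close>

locale exceptional_jacobi =
  fixes F1 F2 :: "nat set" and \<alpha> \<beta> :: real
  assumes fin: "finite F1" "finite F2"
    and nonempty: "F1 \<union> F2 \<noteq> {}"
    and A1: "\<not> neg_int \<alpha>" "\<not> neg_int (\<alpha> + \<beta>)"
    and A2: "F2 \<noteq> {} \<Longrightarrow> \<not> neg_int (\<beta> - real (Max F2) - 1)"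
    and h1: "\<alpha> + real (kF F1 F2) + 1 > 0"
    and h2: "\<beta> + real (card F1) - real (card F2) + 1 > 0"
    and hOmega: "\<forall>x\<in>{-1..1}. poly (OmegaF \<alpha> \<beta> F1 F2) x \<noteq> 0"
begin

definition "k = kF F1 F2"
definition "k1 = card F1"
definition "k2 = card F2"
definition "L1 = sorted_list_of_set F1"
definition "L2 = sorted_list_of_set F2"
definition T :: "nat \<Rightarrow> bool" where "T i \<longleftrightarrow> i < k1"
definition r :: "nat \<Rightarrow> real poly" where
  "r i = (if i < k1 then jacobi \<alpha> \<beta> (L1 ! i) else jacobi \<alpha> (- \<beta>) (L2 ! (i - k1)))"
definition \<mu> :: "nat \<Rightarrow> real" where
  "\<mu> i = (if i < k1 then - real (L1 ! i) * (real (L1 ! i) + \<alpha> + \<beta> + 1)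
     else - (real (L2 ! (i - k1)) - \<beta>) * (real (L2 ! (i - k1)) + \<alpha> + 1))"
definition J :: "nat \<Rightarrow> nat \<Rightarrow> real \<Rightarrow> real" where
  "J i c = (if i < k1 then poly (pder c (r i)) else shifted_jet \<beta> (r i) c)"
definition B :: "nat \<Rightarrow> real poly" where "B = bcoef \<beta> k T r"
definition W :: "real poly mat" where "W = wmat \<beta> k T r"
definition \<Omega> :: "real poly" where "\<Omega> = OmegaF \<alpha> \<beta> F1 F2"
text \<open>The factor between a matrix entry and a derivative of the seed, up to sign:
  \<open>(1+x) powr (\<beta> + e)\<close> clears the F2 entries of real powers.\<close>

definition S :: "nat \<Rightarrow> nat \<Rightarrow> real \<Rightarrow> real" where
  "S e i x = (if i < k1 then 1 else (1 + x) powr (\<beta> + real e))"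
text \<open>W is the seed matrix with row i scaled by \<open>S\<close> and column c by
  \<open>(-1)^c\<close>, so its adjugate over its determinant inverts the seed matrix once both
  scalings are undone.\<close>

definition V :: "nat \<Rightarrow> nat \<Rightarrow> real \<Rightarrow> real" where
  "V c i x = (-1) ^ c * S (k - 1) i x * poly (adj_mat W $$ (c, i)) x / poly (Determinant.det W) x"
text \<open>On polynomials this is \<open>B k\<close> times psi; its coefficients are polynomials,
  so it maps polynomials to polynomials.\<close>

definition L :: "real poly \<Rightarrow> real poly" where "L p = (\<Sum>c\<le>k. B c * pder c p)"

lemma k_eq: "k = k1 + k2" by (simp add: k_def k1_def k2_def kF_def)

lemma k_pos: "0 < k"
  using nonempty fin by (auto simp: k_eq k1_def k2_def card_gt_0_iff)

lemma seed_lists: "length L1 = k1" "set L1 = F1" "length L2 = k2" "set L2 = F2"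
  using fin by (simp_all add: L1_def L2_def k1_def k2_def)

lemma card_F2_rows: "card {i. i < k \<and> \<not> T i} = k2"
proof -
  have "{i. i < k \<and> \<not> T i} = {k1..<k}" by (auto simp: T_def)
  then show ?thesis by (simp add: k_eq)
qed

lemma F2_entry_eq: "F2_entry \<alpha> \<beta> e f c = seed_entry \<beta> e False c (jacobi \<alpha> (- \<beta>) f)"
  by (simp add: F2_entry_def seed_entry_def shifted_row_jacobi)

lemma F1_entry_eq: "F1_entry \<alpha> \<beta> f c = seed_entry \<beta> e True c (jacobi \<alpha> \<beta> f)"
  by (simp add: F1_entry_def seed_entry_def deriv_row_def)

lemma Wmat_eq: "Wmat \<alpha> \<beta> F1 F2 = W"
  unfolding Wmat_def Let_def W_def wmat_def k_def[symmetric] k1_def[symmetric] L1_def[symmetric] L2_def[symmetric]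
  by (rule eq_matI) (auto simp: T_def r_def F2_entry_eq F1_entry_eq[where e = "k - 1"])

lemma Mmat_eq: "Mmat \<alpha> \<beta> F1 F2 n = mmat \<beta> k T r (jacobi \<alpha> \<beta> (n - uF F1 F2))"
  unfolding Mmat_def Let_def mmat_def k_def[symmetric] k1_def[symmetric] L1_def[symmetric] L2_def[symmetric]
  by (rule eq_matI) (auto simp: T_def r_def F2_entry_eq F1_entry_eq[where e = k] seed_entry_def diff_commute)

lemma jacobiF_eq: "jacobiF \<alpha> \<beta> F1 F2 n = L (jacobi \<alpha> \<beta> (n - uF F1 F2))"
  unfolding jacobiF_def Mmat_eq L_def B_def det_mmat_div[symmetric] card_F2_rows by (simp add: k2_def)

lemma B_top_eq: "B k = [:1,1:] ^ k2 * \<Omega>"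
  unfolding B_def bcoef_top card_F2_rows \<Omega>_def OmegaF_def Wmat_eq W_def by (simp add: k2_def)

lemma det_W_eq: "Determinant.det W = [:1,1:] ^ (k2 * (k2 - 1)) * \<Omega>"
proof -
  have "[:1,1:] ^ (k2 * (k2 - 1)) dvd Determinant.det W"
    using dvd_det_seed_entry[of k T \<beta> r] unfolding card_F2_rows W_def wmat_def .
  then show ?thesis unfolding \<Omega>_def OmegaF_def Wmat_eq by (simp add: k2_def)
qed

lemma Omega_nonzero: "x \<in> {-1..1} \<Longrightarrow> poly \<Omega> x \<noteq> 0"
  using hOmega by (simp add: \<Omega>_def)

lemma det_W_nonzero: "x \<in> {-1<..<1} \<Longrightarrow> poly (Determinant.det W) x \<noteq> 0"
  using Omega_nonzero[of x] by (auto simp: det_W_eq)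

lemma W_carrier: "W \<in> carrier_mat k k"
  by (simp add: W_def wmat_def)

lemma seed_entry_eval:
  assumes "-1 < x" "c \<le> e"
  shows "poly (seed_entry \<beta> e (T i) c (r i)) x = S e i x * ((-1) ^ c * J i c x)"
proof (cases "i < k1")
  case True
  then show ?thesis by (simp add: seed_entry_def T_def S_def J_def deriv_row_def)
next
  case False
  have "(1 + x) ^ (e - c) = (1 + x) powr (\<beta> + real e) * (1 + x) powr (- \<beta> - real c)"
    using assms by (simp add: powr_realpow[symmetric] of_nat_diff flip: powr_add)
  then show ?thesis using False
    by (simp add: seed_entry_def T_def S_def J_def shifted_jet_def mult.assoc[symmetric] flip: power_mult_distrib)
qed

lemma W_eval: "-1 < x \<Longrightarrow> i < k \<Longrightarrow> c < k \<Longrightarrow> poly (W $$ (i,c)) x = S (k - 1) i x * ((-1) ^ c * J i c x)"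
  using seed_entry_eval[of x c "k - 1" i] by (simp add: W_def wmat_def)

lemma S_pos: "-1 < x \<Longrightarrow> S e i x > 0"
  by (simp add: S_def)

lemma adj_left:
  assumes "c < k" "c' < k"
  shows "(\<Sum>i<k. adj_mat W $$ (c,i) * W $$ (i,c')) = (if c = c' then Determinant.det W else 0)"
proof -
  note a = adj_mat[OF W_carrier]
  have "(adj_mat W * W) $$ (c,c') = (\<Sum>i<k. adj_mat W $$ (c,i) * W $$ (i,c'))"
    using a(1) W_carrier assms by (simp add: scalar_prod_def lessThan_atLeast0)
  from this[unfolded a(3)] show ?thesis using assms by (cases "c = c'") simp_all
qed

lemma adj_right:
  assumes "i < k" "i' < k"
  shows "(\<Sum>c<k. W $$ (i,c) * adj_mat W $$ (c,i')) = (if i = i' then Determinant.det W else 0)"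
proof -
  note a = adj_mat[OF W_carrier]
  have "(W * adj_mat W) $$ (i,i') = (\<Sum>c<k. W $$ (i,c) * adj_mat W $$ (c,i'))"
    using a(1) W_carrier assms by (simp add: scalar_prod_def lessThan_atLeast0)
  from this[unfolded a(2)] show ?thesis using assms by (cases "i = i'") simp_all
qed

sublocale darboux k J V B \<alpha> \<beta> \<mu>
proof
  fix i c x assume "i < k" "-1 < (x::real)"
  then show "(J i c has_real_derivative J i (Suc c) x) (at x)"
    using shifted_jet_deriv[of x \<beta> "r i" c] poly_DERIV[of "pder c (r i)" x] by (simp add: J_def pder_Suc)
next
  fix i x assume i: "i < k" and x: "x \<in> {-1<..<1::real}"
  show "(1 - x\<^sup>2) * J i 2 x + (\<beta> - \<alpha> - (\<alpha> + \<beta> + 2) * x) * J i 1 x = \<mu> i * J i 0 x"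
  proof (cases "i < k1")
    case True
    then show ?thesis using ejet_jacobi[of \<alpha> \<beta> "L1 ! i"] x unfolding ejet_def by (simp add: J_def r_def \<mu>_def)
  next
    case False
    then show ?thesis using shifted_jet_ode[OF x, of \<beta> \<alpha> "L2 ! (i - k1)"] by (simp add: J_def r_def \<mu>_def)
  qed
next
  fix i x assume i: "i < k" and x: "x \<in> {-1<..<1::real}"
  have "0 = poly (\<Sum>c\<le>k. seed_entry \<beta> k (T i) c (r i) * ((-1) ^ c * B c)) x"
    unfolding B_def bcoef_kills[OF i] by simp
  also have "\<dots> = (\<Sum>c\<le>k. S k i x * (poly (B c) x * J i c x))"
    unfolding poly_sum
  proof (rule sum.cong)
    fix c assume "c \<in> {..k}"
    then have "poly (seed_entry \<beta> k (T i) c (r i)) x = S k i x * ((-1) ^ c * J i c x)"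
      using seed_entry_eval[of x c k i] x by auto
    then show "poly (seed_entry \<beta> k (T i) c (r i) * ((-1) ^ c * B c)) x = S k i x * (poly (B c) x * J i c x)"
      by (cases "even c") auto
  qed simp
  also have "\<dots> = S k i x * (\<Sum>c\<le>k. poly (B c) x * J i c x)" by (simp add: sum_distrib_left)
  finally show "(\<Sum>c\<le>k. poly (B c) x * J i c x) = 0" using S_pos[of x k i] x by auto
next
  fix x assume "x \<in> {-1<..<1::real}"
  then show "poly (B k) x \<noteq> 0" using Omega_nonzero[of x] by (auto simp: B_top_eq)
next
  fix c i x assume "c < k" "i < k" and x: "x \<in> {-1<..<1::real}"
  have "\<exists>D. (S (k - 1) i has_real_derivative D) (at x)"
  proof (cases "i < k1")
    case False
    have "((\<lambda>x. (1 + x) powr (\<beta> + real (k - 1))) has_real_derivative (\<beta> + real (k - 1)) * (1 + x) powr (\<beta> + real (k - 1) - 1)) (at x)"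
      using x by (auto intro!: derivative_eq_intros)
    then show ?thesis using False unfolding S_def[abs_def] by auto
  qed (auto simp: S_def[abs_def] intro!: exI[of _ 0])
  then obtain D where D: "(S (k - 1) i has_real_derivative D) (at x)" ..
  show "\<exists>D. (V c i has_real_derivative D) (at x)"
    unfolding V_def[abs_def]
    by (rule exI, rule DERIV_divide[OF DERIV_mult[OF DERIV_cmult[OF D] poly_DERIV] poly_DERIV det_W_nonzero[OF x]])
next
  fix c c' x assume c: "c < k" "c' < k" and x: "x \<in> {-1<..<1::real}"
  have "(\<Sum>i<k. V c i x * J i c' x) = (\<Sum>i<k. (-1) ^ c * (-1) ^ c' * poly (adj_mat W $$ (c,i) * W $$ (i,c')) x / poly (Determinant.det W) x)"
    by (rule sum.cong) (use W_eval[of x _ c'] x c in \<open>auto simp: V_def minus_one_mult_self[symmetric]\<close>)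
  also have "\<dots> = (-1) ^ c * (-1) ^ c' * poly (\<Sum>i<k. adj_mat W $$ (c,i) * W $$ (i,c')) x / poly (Determinant.det W) x"
    by (simp add: poly_sum sum_divide_distrib sum_distrib_left)
  also have "\<dots> = (if c = c' then 1 else 0)"
    unfolding adj_left[OF c] using det_W_nonzero[OF x] by (simp flip: power_add)
  finally show "(\<Sum>i<k. V c i x * J i c' x) = (if c = c' then 1 else 0)" .
next
  fix i i' x assume i: "i < k" "i' < k" and x: "x \<in> {-1<..<1::real}"
  have "(\<Sum>c<k. J i c x * V c i' x) = (\<Sum>c<k. S (k - 1) i' x / S (k - 1) i x * (poly (W $$ (i,c) * adj_mat W $$ (c,i')) x / poly (Determinant.det W) x))"
    by (rule sum.cong) (use W_eval[of x i] S_pos[of x "k - 1" i] x i in \<open>auto simp: V_def\<close>)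
  also have "\<dots> = S (k - 1) i' x / S (k - 1) i x * (poly (\<Sum>c<k. W $$ (i,c) * adj_mat W $$ (c,i')) x / poly (Determinant.det W) x)"
    by (simp add: poly_sum sum_divide_distrib sum_distrib_left)
  also have "\<dots> = (if i = i' then 1 else 0)"
    unfolding adj_right[OF i] using det_W_nonzero[OF x] S_pos[of x "k - 1" i] S_pos[of x "k - 1" i'] x by simp
  finally show "(\<Sum>c<k. J i c x * V c i' x) = (if i = i' then 1 else 0)" .
qed

section \<open>Nonvanishing and image of the operator\<close>

lemma psi_poly:
  shows "psi (\<lambda>c. poly (pder c p)) x = poly (L p) x / poly (B k) x"
  by (simp add: psi_def a_def L_def poly_sum sum_divide_distrib)

lemma eigenvalue_inj:
  assumes "real n * (real n + \<alpha> + \<beta> + 1) = real m * (real m + \<alpha> + \<beta> + 1)"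
  shows "n = m"
proof (rule ccontr)
  assume "n \<noteq> m"
  have "(real n - real m) * (real n + real m + \<alpha> + \<beta> + 1) = 0" using assms by (simp add: algebra_simps)
  then have "\<alpha> + \<beta> = - real (n + m + 1)" using \<open>n \<noteq> m\<close> by auto
  then show False using A1(2) unfolding neg_int_def by (metis Suc_eq_plus1 zero_less_Suc)
qed

text \<open>For a seed from F2 the difference of the eigenvalues factors as (f - \<beta> - n)(f +
  \<alpha> + 1 + n). The first factor is excluded by (A2) through the largest element of F2, the
  second by (A1) for \<alpha>.\<close>

lemma eigenvalue_not_seed:
  assumes n: "n \<notin> F1" and i: "i < k"
  shows "- real n * (real n + \<alpha> + \<beta> + 1) \<noteq> \<mu> i"
proof
  assume e: "- real n * (real n + \<alpha> + \<beta> + 1) = \<mu> i"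
  show False
  proof (cases "i < k1")
    case True
    then have "L1 ! i \<in> F1" using seed_lists by (metis nth_mem)
    moreover have "n = L1 ! i" using e True by (intro eigenvalue_inj) (simp add: \<mu>_def)
    ultimately show False using n by simp
  next
    case False
    define f where "f = L2 ! (i - k1)"
    have f: "f \<in> F2" using False i seed_lists k_eq unfolding f_def by (metis add.commute less_diff_conv2 not_less nth_mem)
    have "real n * (real n + \<alpha> + \<beta> + 1) = (real f - \<beta>) * (real f + \<alpha> + 1)"
      using e False by (simp add: \<mu>_def f_def algebra_simps)
    then have "(real f - \<beta> - real n) * (real f + \<alpha> + 1 + real n) = 0" by (simp add: algebra_simps)
    then consider "\<beta> = real f - real n" | "\<alpha> = - real (f + n + 1)" by fastforce
    then show False
    proof cases
      case 1
      have "f \<le> Max F2" using f fin by simp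
      then have "\<beta> - real (Max F2) - 1 = - real (Max F2 - f + n + 1)" using 1 by (simp add: of_nat_diff)
      then have "neg_int (\<beta> - real (Max F2) - 1)" unfolding neg_int_def by (intro exI[of _ "Max F2 - f + n + 1"]) simp
      then show False using A2 f by auto
    next
      case 2
      then have "neg_int \<alpha>" unfolding neg_int_def by (intro exI[of _ "f + n + 1"]) simp
      then show False using A1 by simp
    qed
  qed
qed

text \<open>Otherwise the eigenfunction P_n would lie in the kernel of psi although its eigenvalue
  is not that of a seed.\<close>

lemma L_jacobi_nonzero:
  assumes "n \<notin> F1"
  shows "L (jacobi \<alpha> \<beta> n) \<noteq> 0"
proof
  assume "L (jacobi \<alpha> \<beta> n) = 0"
  then have "poly (jacobi \<alpha> \<beta> n) x = 0" if "x \<in> {-1<..<1}" for x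
    using kernel_eigen[OF ejet_jacobi[of \<alpha> \<beta> n] _ eigenvalue_not_seed[OF assms] that]
    by (simp add: psi_poly)
  then have "{-1<..<1} \<subseteq> {x. poly (jacobi \<alpha> \<beta> n) x = 0}" by auto
  then have "finite {-1<..<1::real}"
    using poly_roots_finite[OF jacobi_nonzero[OF A1(2)]] finite_subset by blast
  then show False by (simp add: infinite_Ioo)
qed

lemma L_jacobi_seed:
  assumes "f \<in> F1"
  shows "L (jacobi \<alpha> \<beta> f) = 0"
proof -
  obtain i where i: "i < k1" "L1 ! i = f" using assms seed_lists by (metis in_set_conv_nth)
  then have "i < k" by (simp add: k_eq)
  have "(\<Sum>c\<le>k. seed_entry \<beta> k (T i) c (r i) * ((-1) ^ c * B c)) = 0"
    unfolding B_def by (rule bcoef_kills[OF \<open>i < k\<close>])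
  moreover have "seed_entry \<beta> k (T i) c (r i) * ((-1) ^ c * B c) = B c * pder c (jacobi \<alpha> \<beta> f)" for c
    using i by (cases "even c") (auto simp: seed_entry_def T_def r_def deriv_row_def)
  ultimately show ?thesis by (simp add: L_def)
qed

lemma L_sum: "L (\<Sum>a\<in>A. Polynomial.smult (d a) (P a)) = (\<Sum>a\<in>A. Polynomial.smult (d a) (L (P a)))"
proof -
  have add: "L (p + q) = L p + L q" for p q by (simp add: L_def pder_add algebra_simps sum.distrib)
  have sm: "L (Polynomial.smult a p) = Polynomial.smult a (L p)" for a p
    by (simp add: L_def pder_smult smult_sum_right)
  have "L 0 = 0" using sm[of 0 0] by simp
  then show ?thesis
    by (induction A rule: infinite_finite_induct) (auto simp: add sm)
qed

text \<open>Expand p in all Jacobi polynomials: those indexed by F1 are killed, and the other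
  indices, shifted by \<open>uF F1 F2\<close>, lie in sigma.\<close>

lemma range_L:
  "\<exists>S c. finite S \<and> S \<subseteq> sigmaF F1 F2 \<and> (\<forall>x. poly (L p) x = (\<Sum>n\<in>S. c n * poly (jacobiF \<alpha> \<beta> F1 F2 n) x))"
proof -
  let ?u = "uF F1 F2"
  define N where "N = degree p"
  obtain d where d: "p = (\<Sum>a\<le>N. Polynomial.smult (d a) (jacobi \<alpha> \<beta> a))"
    using poly_basis[of "jacobi \<alpha> \<beta>" p N] degree_jacobi[OF A1(2)] jacobi_nonzero[OF A1(2)] N_def by auto
  define R where "R = {..N} - F1"
  have "L p = (\<Sum>a\<le>N. Polynomial.smult (d a) (L (jacobi \<alpha> \<beta> a)))" by (subst d) (rule L_sum)
  also have "\<dots> = (\<Sum>a\<in>R. Polynomial.smult (d a) (L (jacobi \<alpha> \<beta> a)))"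
    by (rule sum.mono_neutral_right) (auto simp: R_def L_jacobi_seed)
  finally have Lp: "poly (L p) x = (\<Sum>a\<in>R. d a * poly (L (jacobi \<alpha> \<beta> a)) x)" for x
    by (simp add: poly_sum)
  have "(\<Sum>a\<in>R. d a * poly (L (jacobi \<alpha> \<beta> a)) x) = (\<Sum>n\<in>(\<lambda>a. ?u + a) ` R. d (n - ?u) * poly (jacobiF \<alpha> \<beta> F1 F2 n) x)" for x
    by (subst sum.reindex) (auto simp: jacobiF_eq inj_on_def)
  then show ?thesis unfolding Lp
    by (intro exI[of _ "(\<lambda>a. ?u + a) ` R"] exI[of _ "\<lambda>n. d (n - ?u)"]) (auto simp: R_def sigmaF_def)
qed

section \<open>Weight, orthogonality and density\<close>

abbreviation wt :: "real \<Rightarrow> real" where "wt \<equiv> weightF \<alpha> \<beta> F1 F2"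

lemma w_eq: "wt x = 1 / (poly \<Omega> x)\<^sup>2 * ((1 - x) powr (\<alpha> + real k) * (1 + x) powr (\<beta> + real k1 - real k2))"
  by (simp add: weightF_def \<Omega>_def k_def k1_def k2_def)

lemma w_pos: "x \<in> {-1<..<1} \<Longrightarrow> wt x > 0"
  using Omega_nonzero[of x] by (auto simp: w_eq intro!: mult_pos_pos divide_pos_pos)

lemma poly_measurable [measurable]: "poly p \<in> borel_measurable borel"
  for p :: "real poly"
  by (intro borel_measurable_continuous_onI continuous_intros)

lemma w_measurable: "wt \<in> borel_measurable lborel"
  unfolding w_eq[abs_def] by measurable

text \<open>Omega has no zero on the closed interval, so 1/Omega^2 is bounded there, and
  \<open>h1\<close> and \<open>h2\<close> put both exponents of the Jacobi weight above -1.\<close>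

lemma w_integrable: "set_integrable lborel {-1<..<1} wt"
  unfolding w_eq[abs_def]
proof (rule set_integrable_continuous_mult)
  show "set_integrable lborel {-1<..<1} (\<lambda>x. (1 - x) powr (\<alpha> + real k) * (1 + x) powr (\<beta> + real k1 - real k2))"
    by (rule set_integrable_jacobi_weight) (use h1 h2 in \<open>auto simp: k_def k1_def k2_def\<close>)
  show "continuous_on {-1..1} (\<lambda>x. 1 / (poly \<Omega> x)\<^sup>2)"
    using Omega_nonzero by (intro continuous_intros) auto
qed measurable

lemma poly_w_integrable: "set_integrable lborel {-1<..<1} (\<lambda>x. poly p x * wt x)"
  by (rule set_integrable_continuous_mult[OF w_integrable]) (auto intro!: continuous_intros)

lemma orthogonal:
  assumes nm: "n \<noteq> m"
  shows "(LBINT x:{-1<..<1}. poly (L (jacobi \<alpha> \<beta> n)) x * poly (L (jacobi \<alpha> \<beta> m)) x * wt x) = 0"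
proof -
  define l where "l n = - real n * (real n + \<alpha> + \<beta> + 1)" for n
  define A where "A = L (jacobi \<alpha> \<beta> n)"
  define C where "C = L (jacobi \<alpha> \<beta> m)"
  define Y where "Y = (\<lambda>c. poly (pder c (jacobi \<alpha> \<beta> n)))"
  define Z where "Z = (\<lambda>c. poly (pder c (jacobi \<alpha> \<beta> m)))"
  \<comment> \<open>The weighted Wronskian of \<open>psi Y\<close> and \<open>psi Z\<close> with the
    powers of 1+x from \<open>B k\<close> cancelled; in this form it extends continuously to the
    endpoints.\<close>
  define G where "G x = (1 - x) powr (\<alpha> + real k + 1) * (1 + x) powr (\<beta> + real k1 - real k2 + 1)
     * (poly (pderiv A * C - A * pderiv C) x / (poly \<Omega> x)\<^sup>2)" for x
  define g where "g x = (l n - l m) * (poly A x * poly C x * wt x)" for x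
  have ex: "\<alpha> + real k + 1 > 0" "\<beta> + real k1 - real k2 + 1 > 0"
    using h1 h2 by (simp_all add: k_def k1_def k2_def)
  have psi1_eq: "psi1 (\<lambda>c. poly (pder c p)) x = (poly (pderiv (L p)) x * poly (B k) x - poly (L p) x * poly (pderiv (B k)) x) / (poly (B k) x * poly (B k) x)"
    if x: "x \<in> {-1<..<1}" for p x
  proof (rule has_derivative_eq_on_open[of "{-1<..<1}" x])
    show "(psi (\<lambda>c. poly (pder c p)) has_real_derivative psi1 (\<lambda>c. poly (pder c p)) x) (at x)"
      by (rule psi_deriv[OF jet_poly x])
    show "((\<lambda>x. poly (L p) x / poly (B k) x) has_real_derivative (poly (pderiv (L p)) x * poly (B k) x - poly (L p) x * poly (pderiv (B k)) x) / (poly (B k) x * poly (B k) x)) (at x)"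
      by (intro DERIV_divide poly_DERIV B_top x)
  qed (use x psi_poly in auto)
  have dG: "(G has_real_derivative g x) (at x)" if x: "x \<in> {-1<..<1}" for x
  proof -
    \<comment> \<open>\<open>B k\<close> contains \<open>(1+x)^k2\<close>, and k - 2 k2 = k1 - k2.
      The case e = 1 serves the boundary expression, e = 0 the weight.\<close>
    have Dpow: "(1 + y) powr (\<beta> + real k + e) / (poly (B k) y)\<^sup>2 = (1 + y) powr (\<beta> + real k1 - real k2 + e) / (poly \<Omega> y)\<^sup>2"
      if y: "y \<in> {-1<..<1}" for y e
    proof -
      have "(1 + y) powr (\<beta> + real k + e) = (1 + y) powr (\<beta> + real k1 - real k2 + e) * ((1 + y) ^ k2)\<^sup>2"
        using y by (simp add: powr_realpow[symmetric] k_eq power2_eq_square flip: powr_add) (simp add: algebra_simps)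
      then show ?thesis using y by (simp add: B_top_eq power_mult_distrib)
    qed
    have "G y = (1 - y) powr (\<alpha> + real k + 1) * (1 + y) powr (\<beta> + real k + 1) * (psi1 Y y * psi Z y - psi Y y * psi1 Z y)"
      if y: "y \<in> {-1<..<1}" for y
    proof -
      have Bn: "poly (B k) y \<noteq> 0" by (rule B_top[OF y])
      have "psi1 Y y * psi Z y - psi Y y * psi1 Z y = poly (pderiv A * C - A * pderiv C) y / (poly (B k) y)\<^sup>2"
        unfolding Y_def Z_def psi1_eq[OF y] psi_poly A_def[symmetric] C_def[symmetric]
        using Bn by (simp add: field_simps power2_eq_square)
      then have "(1 - y) powr (\<alpha> + real k + 1) * (1 + y) powr (\<beta> + real k + 1) * (psi1 Y y * psi Z y - psi Y y * psi1 Z y)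
        = (1 - y) powr (\<alpha> + real k + 1) * ((1 + y) powr (\<beta> + real k + 1) / (poly (B k) y)\<^sup>2) * poly (pderiv A * C - A * pderiv C) y"
        by simp
      also have "\<dots> = G y" unfolding Dpow[OF y] G_def by simp
      finally show ?thesis by simp
    qed
    moreover have "((\<lambda>x. (1 - x) powr (\<alpha> + real k + 1) * (1 + x) powr (\<beta> + real k + 1) * (psi1 Y x * psi Z x - psi Y x * psi1 Z x))
       has_real_derivative (l n - l m) * ((1 - x) powr (\<alpha> + real k) * (1 + x) powr (\<beta> + real k) * (psi Y x * psi Z x))) (at x)"
      unfolding Y_def Z_def l_def by (rule wronskian_deriv[OF ejet_jacobi ejet_jacobi x])
    moreover have "(1 - x) powr (\<alpha> + real k) * (1 + x) powr (\<beta> + real k) * (psi Y x * psi Z x) = poly A x * poly C x * wt x"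
    proof -
      have "(1 - x) powr (\<alpha> + real k) * (1 + x) powr (\<beta> + real k) * (psi Y x * psi Z x)
        = (1 - x) powr (\<alpha> + real k) * ((1 + x) powr (\<beta> + real k + 0) / (poly (B k) x)\<^sup>2) * (poly A x * poly C x)"
        unfolding Y_def Z_def psi_poly A_def[symmetric] C_def[symmetric] by (simp add: power2_eq_square)
      then show ?thesis unfolding Dpow[OF x] by (simp add: w_eq)
    qed
    ultimately show ?thesis unfolding g_def
      by (auto intro: has_field_derivative_transform_within_open[OF _ _ x])
  qed
  have "(LBINT x:{-1<..<1}. g x) = 0"
  proof (rule lbint_derivative_eq_0[OF _ _ _ dG])
    \<comment> \<open>The exponents are positive, hence continuity and the value 0 at the
      endpoints.\<close>
    have c1: "continuous_on {-1..1} (\<lambda>x. (1 - x) powr (\<alpha> + real k + 1))"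
      by (rule continuous_on_powr') (use ex in \<open>auto intro!: continuous_intros\<close>)
    have c2: "continuous_on {-1..1} (\<lambda>x. (1 + x) powr (\<beta> + real k1 - real k2 + 1))"
      by (rule continuous_on_powr') (use ex in \<open>auto intro!: continuous_intros\<close>)
    have c3: "continuous_on {-1..1} (\<lambda>x. poly (pderiv A * C - A * pderiv C) x / (poly \<Omega> x)\<^sup>2)"
      using Omega_nonzero by (intro continuous_intros) auto
    show "continuous_on {-1..1} G"
      unfolding G_def by (intro continuous_on_mult c1 c2 c3)
    show "set_integrable lborel {-1<..<1} g"
      using poly_w_integrable[of "A * C"] unfolding g_def by (simp add: mult.assoc)
  qed (simp_all add: G_def)
  then have "(l n - l m) * (LBINT x:{-1<..<1}. poly A x * poly C x * wt x) = 0"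
    unfolding g_def by simp
  moreover have "l n \<noteq> l m" using eigenvalue_inj[of n m] nm by (auto simp: l_def)
  ultimately show ?thesis by (simp add: A_def C_def)
qed

lemma dense:
  assumes f: "f \<in> borel_measurable lborel"
    and fi: "set_integrable lborel {-1<..<1} (\<lambda>x. (f x)\<^sup>2 * wt x)" and \<epsilon>: "\<epsilon> > 0"
  shows "\<exists>S c. finite S \<and> S \<subseteq> sigmaF F1 F2 \<and>
    (LBINT x:{-1<..<1}. (f x - (\<Sum>n\<in>S. c n * poly (jacobiF \<alpha> \<beta> F1 F2 n) x))\<^sup>2 * wt x) < \<epsilon>"
proof -
  have "\<exists>q. (\<exists>p. q = L p) \<and> (LBINT x:{-1<..<1}. (f x - poly q x)\<^sup>2 * wt x) < \<epsilon>"
  proof (rule dense_if_uniformly_dense[OF f w_measurable _ w_integrable fi \<epsilon>])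
    fix h :: "real \<Rightarrow> real" and \<delta> \<eta> :: real
    assume "continuous_on UNIV h" "0 < \<delta>" "\<delta> < 1" "\<And>x. \<bar>x\<bar> > 1 - \<delta> \<Longrightarrow> h x = 0" "0 < \<eta>"
    then show "\<exists>q. (\<exists>p. q = L p) \<and> (\<forall>x\<in>{-1<..<1}. \<bar>h x - poly q x\<bar> < \<eta>)"
      using uniform_approximation[of h \<delta> \<eta>] k_pos unfolding L_def by blast
  qed (use w_pos in \<open>auto intro: less_imp_le\<close>)
  then obtain p where p: "(LBINT x:{-1<..<1}. (f x - poly (L p) x)\<^sup>2 * wt x) < \<epsilon>" by blast
  obtain S c where S: "finite S" "S \<subseteq> sigmaF F1 F2" "\<And>x. poly (L p) x = (\<Sum>n\<in>S. c n * poly (jacobiF \<alpha> \<beta> F1 F2 n) x)"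
    using range_L[of p] by blast
  show ?thesis using S(1,2) p unfolding S(3) by blast
qed

text \<open>Since u <= n on sigma, truncated subtraction of u is injective there, so distinct n give
  distinct Jacobi degrees outside F1.\<close>

lemma sigmaD: "n \<in> sigmaF F1 F2 \<Longrightarrow> uF F1 F2 \<le> n \<and> n - uF F1 F2 \<notin> F1"
proof -
  assume n: "n \<in> sigmaF F1 F2"
  then have "uF F1 F2 \<le> n" "\<And>f. f \<in> F1 \<Longrightarrow> n \<noteq> uF F1 F2 + f" by (auto simp: sigmaF_def)
  then show ?thesis by (metis le_add_diff_inverse)
qed

end

theorem theorem6p1:
  fixes F1 F2 :: "nat set" and \<alpha> \<beta> :: real
  assumes fin: "finite F1" "finite F2"
    and pos: "0 \<notin> F1" "0 \<notin> F2"
    and nonempty: "F1 \<union> F2 \<noteq> {}"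
    and A1: "\<not> neg_int \<alpha>" "\<not> neg_int \<beta>" "\<not> neg_int (\<alpha> + \<beta>)"
    and A2: "F2 \<noteq> {} \<Longrightarrow> \<not> neg_int (\<alpha> - \<beta>) \<and> \<not> neg_int (\<beta> - real (Max F2) - 1)"
    and h1: "\<alpha> + real (kF F1 F2) + 1 > 0"
    and h2: "\<beta> + real (card F1) - real (card F2) + 1 > 0"
    and hOmega: "\<forall>x\<in>{-1..1}. poly (OmegaF \<alpha> \<beta> F1 F2) x \<noteq> 0"
  shows "(\<forall>x\<in>{-1<..<1::real}. weightF \<alpha> \<beta> F1 F2 x > 0)
    \<and> (\<forall>n\<in>sigmaF F1 F2. \<forall>m\<in>sigmaF F1 F2.
          set_integrable lborel {-1<..<1::real}
            (\<lambda>x. poly (jacobiF \<alpha> \<beta> F1 F2 n) x * poly (jacobiF \<alpha> \<beta> F1 F2 m) x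
                   * weightF \<alpha> \<beta> F1 F2 x)
          \<and> (n \<noteq> m \<longrightarrow> (LBINT x:{-1<..<1}. poly (jacobiF \<alpha> \<beta> F1 F2 n) x
                   * poly (jacobiF \<alpha> \<beta> F1 F2 m) x * weightF \<alpha> \<beta> F1 F2 x) = 0))
    \<and> (\<forall>n\<in>sigmaF F1 F2. (LBINT x:{-1<..<1}. (poly (jacobiF \<alpha> \<beta> F1 F2 n) x)\<^sup>2
                   * weightF \<alpha> \<beta> F1 F2 x) > 0)
    \<and> (\<forall>f :: real \<Rightarrow> real. f \<in> borel_measurable lborel \<longrightarrow>
          set_integrable lborel {-1<..<1} (\<lambda>x. (f x)\<^sup>2 * weightF \<alpha> \<beta> F1 F2 x) \<longrightarrow>
          (\<forall>\<epsilon>>0. \<exists>S c. finite S \<and> S \<subseteq> sigmaF F1 F2 \<and>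
             (LBINT x:{-1<..<1}. (f x - (\<Sum>n\<in>S. c n * poly (jacobiF \<alpha> \<beta> F1 F2 n) x))\<^sup>2
                * weightF \<alpha> \<beta> F1 F2 x) < \<epsilon>))"
proof -
  interpret exceptional_jacobi F1 F2 \<alpha> \<beta>
    by unfold_locales (use assms in auto)
  let ?P = "jacobiF \<alpha> \<beta> F1 F2"
  have int: "set_integrable lborel {-1<..<1} (\<lambda>x. poly (?P n) x * poly (?P m) x * wt x)" for n m
    using poly_w_integrable[of "?P n * ?P m"] by simp
  have orth: "(LBINT x:{-1<..<1}. poly (?P n) x * poly (?P m) x * wt x) = 0"
    if "n \<in> sigmaF F1 F2" "m \<in> sigmaF F1 F2" "n \<noteq> m" for n m
    unfolding jacobiF_eq by (rule orthogonal) (use sigmaD[OF that(1)] sigmaD[OF that(2)] that(3) in arith)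
  have norm: "(LBINT x:{-1<..<1}. (poly (?P n) x)\<^sup>2 * wt x) > 0" if "n \<in> sigmaF F1 F2" for n
  proof (rule lbint_poly_square_pos)
    show "?P n \<noteq> 0" unfolding jacobiF_eq by (rule L_jacobi_nonzero) (use sigmaD that in blast)
    show "set_integrable lborel {-1<..<1} (\<lambda>x. (poly (?P n) x)\<^sup>2 * wt x)"
      using int[of n n] by (simp add: power2_eq_square)
  qed (rule w_pos)
  show ?thesis
    by (intro conjI ballI allI impI) (rule w_pos int orth norm dense; assumption)+
qed

end
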